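(* Let $n\ge3$, let $(M^n,g_{ij})$ be a compact Riemannian manifold with smooth boundary, let $f\in C^\infty(M^n\times\mathbb{R})$, let $\underline u$ be a smooth admissible subsolution, let $\overline u$ be a supersolution, and assume that $M^n$ admits a smooth strictly convex function, with $\psi_k$, $\lambda$ and these notions as in the context. Then there exists a constant $C$, independent of $k\in\mathbb{N}$ (and of $u$), such that for every $\psi=\psi_k$ every smooth (up to the boundary) admissible solution $u$ with $\underline u\le u\le\overline u$ of $$\begin{cases}\log\dfrac{\det\left(u_{ij}+\psi u_iu_j-\tfrac12\psi|\nabla u|^2g_{ij}+T_{ij}\right)}{\det(g_{ij})}=f(x,u)&\text{in }M^n,\\ u=\underline u&\text{on }\partial M^n,\end{cases}\qquad T_{ij}=S_{ij}+\lambda(1-\psi)g_{ij},$$ satisfies $|\nabla u|\le C$ on $M^n$.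
   Context: Indices of functions denote covariant derivatives with respect to the background metric $g_{ij}$, and $|\nabla u|^2=g^{ij}u_iu_j$. The Schouten tensor of $g_{ij}$, with Ricci tensor $R_{ij}$ and scalar curvature $R$, is $S_{ij}=\frac1{n-2}\left(R_{ij}-\frac1{2(n-1)}Rg_{ij}\right)$. All data are smooth up to the boundary. An admissible subsolution is a function $\underline u$, smooth up to the boundary, such that $\underline u_{ij}+\underline u_i\underline u_j-\frac12|\nabla\underline u|^2g_{ij}+S_{ij}$ is positive definite and $\log\left(\det(\underline u_{ij}+\underline u_i\underline u_j-\frac12|\nabla\underline u|^2g_{ij}+S_{ij})/\det(g_{ij})\right)\ge f(x,\underline u)$ on $M^n$. For each $k\in\mathbb{N}$, $\psi_k:M^n\to[0,1]$ is a fixed smooth function with $\psi_k(x)=0$ if $\mathrm{dist}(x,\partial M^n)<\frac1k$ and $\psi_k(x)=1$ if $\mathrm{dist}(x,\partial M^n)>\frac2k$. The constant $\lambda\ge0$ is fixed, independently of $k$, so large that for every $\psi=\psi_k$ the tensor $\underline u_{ij}+\psi\underline u_i\underline u_j-\frac12\psi|\nabla\underline u|^2g_{ij}+S_{ij}+\lambda(1-\psi)g_{ij}$ is positive definite and the logarithm of its determinant divided by $\det(g_{ij})$ is $\ge f(x,\underline u)$ on $M^n$. A supersolution is a function $\overline u$, smooth up to the boundary, with $\overline u\ge\underline u$ and such that, for every $\psi=\psi_k$, $\log\left(\det(\overline u_{ij}+\psi\overline u_i\overline u_j-\frac12\psi|\nabla\overline u|^2g_{ij}+S_{ij}+\lambda(1-\psi)g_{ij})/\det(g_{ij})\right)\le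 f(x,\overline u)$ at all points where the tensor in the determinant is positive definite. A solution $u$ of the boundary value problem is admissible if $u_{ij}+\psi u_iu_j-\frac12\psi|\nabla u|^2g_{ij}+T_{ij}$ is positive definite on $M^n$. A function $\chi$ is strictly convex if its covariant Hessian $\chi_{ij}$ is positive definite on $M^n$. *)

theory Defs
  imports "HOL-Analysis.Analysis"
begin

text \<open>
  Smooth compact manifolds with boundary are modelled by an atlas of charts onto relatively open
  subsets of a closed half-space of \<open>real ^ 'n\<close>. Tensors are given, as in classical index notation,
  by their component matrices in each chart; \<open>'n\<close> is the index type, so the dimension is
  \<open>CARD('n)\<close>.
\<close>

section \<open>Calculus up to the boundary of a half-space\<close>

text \<open>
  All derivatives are taken within the set \<open>S\<close>. For \<open>S\<close> relatively open in a half-space (or a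
  half-space times a line) they are unique and depend only on the values on \<open>S\<close>, and
  \<open>smooth_within S f\<close> is smoothness up to the boundary: every iterated partial derivative exists
  and is continuous on \<open>S\<close>, including the points of \<open>S\<close> on the boundary hyperplane.
\<close>

definition dir_deriv ::
    "'a::euclidean_space set \<Rightarrow> 'a \<Rightarrow> ('a \<Rightarrow> 'b::real_normed_vector) \<Rightarrow> 'a \<Rightarrow> 'b" where
  "dir_deriv S v f x = frechet_derivative f (at x within S) v"

fun Ck_within ::
    "nat \<Rightarrow> 'a::euclidean_space set \<Rightarrow> ('a \<Rightarrow> 'b::real_normed_vector) \<Rightarrow> bool" where
  "Ck_within 0 S f \<longleftrightarrow> continuous_on S f"
| "Ck_within (Suc k) S f \<longleftrightarrow>
     f differentiable_on S \<and> (\<forall>v\<in>Basis. Ck_within k S (dir_deriv S v f))"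

definition smooth_within ::
    "'a::euclidean_space set \<Rightarrow> ('a \<Rightarrow> 'b::real_normed_vector) \<Rightarrow> bool" where
  "smooth_within S f \<longleftrightarrow> (\<forall>k. Ck_within k S f)"

definition pd :: "(real^'n) set \<Rightarrow> 'n \<Rightarrow> (real^'n \<Rightarrow> real) \<Rightarrow> real^'n \<Rightarrow> real" where
  "pd S i f x = dir_deriv S (axis i 1) f x"

definition half_space :: "'n::finite \<Rightarrow> (real^'n) set" where
  "half_space b = {x. 0 \<le> x $ b}"

definition pos_def :: "real^'n^'n \<Rightarrow> bool" where
  "pos_def B \<longleftrightarrow> (\<forall>v. v \<noteq> 0 \<longrightarrow> 0 < v \<bullet> (B *v v))"


section \<open>Riemannian geometry in coordinates\<close>

text \<open>Here \<open>G\<close> is the matrix \<open>(g\<^sub>i\<^sub>j)\<close> of a metric as a function of coordinates ranging over \<open>S\<close>.\<close>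

definition ginv :: "(real^'n \<Rightarrow> real^'n^'n) \<Rightarrow> real^'n \<Rightarrow> 'n \<Rightarrow> 'n \<Rightarrow> real" where
  "ginv G x i j = matrix_inv (G x) $ i $ j"

text \<open>\<open>christoffel S G k i j\<close> is the symbol with upper index \<open>k\<close> and lower indices \<open>i j\<close>.\<close>

definition christoffel ::
    "(real^'n) set \<Rightarrow> (real^'n \<Rightarrow> real^'n^'n) \<Rightarrow> 'n \<Rightarrow> 'n \<Rightarrow> 'n \<Rightarrow> real^'n \<Rightarrow> real" where
  "christoffel S G k i j x = 1/2 * (\<Sum>l\<in>UNIV. ginv G x k l *
     (pd S i (\<lambda>y. G y $ j $ l) x + pd S j (\<lambda>y. G y $ i $ l) x - pd S l (\<lambda>y. G y $ i $ j) x))"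

text \<open>\<open>riemann S G l k i j\<close> is the component with upper index \<open>l\<close> and lower indices \<open>k i j\<close>, that is,
  the \<open>l\<close>-th component of \<open>R(\<partial>\<^sub>i, \<partial>\<^sub>j) \<partial>\<^sub>k\<close>. With this sign the Ricci tensor of a round sphere
  is positive.\<close>

definition riemann ::
    "(real^'n) set \<Rightarrow> (real^'n \<Rightarrow> real^'n^'n) \<Rightarrow> 'n \<Rightarrow> 'n \<Rightarrow> 'n \<Rightarrow> 'n \<Rightarrow> real^'n \<Rightarrow> real" where
  "riemann S G l k i j x =
     pd S i (christoffel S G l j k) x - pd S j (christoffel S G l i k) x
     + (\<Sum>m\<in>UNIV. christoffel S G l i m x * christoffel S G m j k x
                 - christoffel S G l j m x * christoffel S G m i k x)"

definition ricci ::
    "(real^'n) set \<Rightarrow> (real^'n \<Rightarrow> real^'n^'n) \<Rightarrow> 'n \<Rightarrow> 'n \<Rightarrow> real^'n \<Rightarrow> real" where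
  "ricci S G i j x = (\<Sum>m\<in>UNIV. riemann S G m i m j x)"

definition scalar_curv :: "(real^'n) set \<Rightarrow> (real^'n \<Rightarrow> real^'n^'n) \<Rightarrow> real^'n \<Rightarrow> real" where
  "scalar_curv S G x = (\<Sum>i\<in>UNIV. \<Sum>j\<in>UNIV. ginv G x i j * ricci S G i j x)"

definition schouten_coord ::
    "(real^'n) set \<Rightarrow> (real^'n \<Rightarrow> real^'n^'n) \<Rightarrow> real^'n \<Rightarrow> real^'n^'n" where
  "schouten_coord S G x = (\<chi> i j. 1 / (real CARD('n) - 2) *
     (ricci S G i j x - 1 / (2 * (real CARD('n) - 1)) * scalar_curv S G x * G x $ i $ j))"

definition hess_coord ::
    "(real^'n) set \<Rightarrow> (real^'n \<Rightarrow> real^'n^'n) \<Rightarrow> (real^'n \<Rightarrow> real) \<Rightarrow> real^'n \<Rightarrow> real^'n^'n" where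
  "hess_coord S G f x = (\<chi> i j.
     pd S i (pd S j f) x - (\<Sum>k\<in>UNIV. christoffel S G k i j x * pd S k f x))"

definition grad_sq_coord ::
    "(real^'n) set \<Rightarrow> (real^'n \<Rightarrow> real^'n^'n) \<Rightarrow> (real^'n \<Rightarrow> real) \<Rightarrow> real^'n \<Rightarrow> real" where
  "grad_sq_coord S G f x = (\<Sum>i\<in>UNIV. \<Sum>j\<in>UNIV. ginv G x i j * pd S i f x * pd S j f x)"


section \<open>Riemannian manifolds with boundary\<close>

type_synonym ('a, 'n) chart = "'a set \<times> ('a \<Rightarrow> real^'n)"

abbreviation cdom :: "('a, 'n::finite) chart \<Rightarrow> 'a set" where "cdom c \<equiv> fst c"
abbreviation cmap :: "('a, 'n::finite) chart \<Rightarrow> 'a \<Rightarrow> real^'n" where "cmap c \<equiv> snd c"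

definition cimg :: "('a, 'n::finite) chart \<Rightarrow> (real^'n) set" where
  "cimg c = cmap c ` cdom c"

definition cinv :: "('a, 'n::finite) chart \<Rightarrow> real^'n \<Rightarrow> 'a" where
  "cinv c = inv_into (cdom c) (cmap c)"

text \<open>
  \<open>bcoord\<close> is the coordinate that is nonnegative in every chart and vanishes exactly on the boundary
  (the index type has no distinguished element). \<open>metric M c p\<close> is the matrix of the metric
  at \<open>p\<close> in the chart \<open>c\<close>.
\<close>

record ('a, 'n::finite) riem =
  mtop :: "'a topology"
  bcoord :: 'n
  atlas :: "('a, 'n::finite) chart set"
  metric :: "('a, 'n::finite) chart \<Rightarrow> 'a \<Rightarrow> real^'n^'n"

abbreviation carrier_of :: "('a, 'n::finite) riem \<Rightarrow> 'a set" where
  "carrier_of M \<equiv> topspace (mtop M)"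

definition is_chart :: "('a, 'n::finite) riem \<Rightarrow> ('a, 'n) chart \<Rightarrow> bool" where
  "is_chart M c \<longleftrightarrow> openin (mtop M) (cdom c) \<and>
     openin (top_of_set (half_space (bcoord M))) (cimg c) \<and>
     homeomorphic_map (subtopology (mtop M) (cdom c)) (top_of_set (cimg c)) (cmap c)"

definition transition :: "('a, 'n::finite) chart \<Rightarrow> ('a, 'n) chart \<Rightarrow> real^'n \<Rightarrow> real^'n" where
  "transition c d = cmap d \<circ> cinv c"

definition overlap :: "('a, 'n::finite) chart \<Rightarrow> ('a, 'n) chart \<Rightarrow> (real^'n) set" where
  "overlap c d = cmap c ` (cdom c \<inter> cdom d)"

text \<open>\<open>jacobian c d p $ i $ j\<close> is the derivative of the \<open>i\<close>-th \<open>d\<close>-coordinate with respect to the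
  \<open>j\<close>-th \<open>c\<close>-coordinate.\<close>

definition jacobian :: "('a, 'n::finite) chart \<Rightarrow> ('a, 'n) chart \<Rightarrow> 'a \<Rightarrow> real^'n^'n" where
  "jacobian c d p =
     matrix (frechet_derivative (transition c d) (at (cmap c p) within overlap c d))"

definition smooth_manifold_with_boundary :: "('a, 'n::finite) riem \<Rightarrow> bool" where
  "smooth_manifold_with_boundary M \<longleftrightarrow>
     Hausdorff_space (mtop M) \<and> second_countable (mtop M) \<and>
     (\<forall>c\<in>atlas M. is_chart M c) \<and> (\<Union>c\<in>atlas M. cdom c) = carrier_of M \<and>
     (\<forall>c\<in>atlas M. \<forall>d\<in>atlas M. smooth_within (overlap c d) (transition c d))"

definition riemannian_metric :: "('a, 'n::finite) riem \<Rightarrow> bool" where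
  "riemannian_metric M \<longleftrightarrow>
     (\<forall>c\<in>atlas M. smooth_within (cimg c) (\<lambda>x. metric M c (cinv c x)) \<and>
        (\<forall>p\<in>cdom c. transpose (metric M c p) = metric M c p \<and> pos_def (metric M c p))) \<and>
     (\<forall>c\<in>atlas M. \<forall>d\<in>atlas M. \<forall>p\<in>cdom c \<inter> cdom d.
        metric M c p = transpose (jacobian c d p) ** metric M d p ** jacobian c d p)"

definition compact_riemannian_manifold_with_boundary :: "('a, 'n::finite) riem \<Rightarrow> bool" where
  "compact_riemannian_manifold_with_boundary M \<longleftrightarrow>
     smooth_manifold_with_boundary M \<and> riemannian_metric M \<and> compact_space (mtop M)"

definition mboundary :: "('a, 'n::finite) riem \<Rightarrow> 'a set" where
  "mboundary M = {p. \<exists>c\<in>atlas M. p \<in> cdom c \<and> cmap c p $ bcoord M = 0}"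

definition smooth_fun :: "('a, 'n::finite) riem \<Rightarrow> ('a \<Rightarrow> real) \<Rightarrow> bool" where
  "smooth_fun M u \<longleftrightarrow> (\<forall>c\<in>atlas M. smooth_within (cimg c) (u \<circ> cinv c))"

definition smooth_fun_times_real :: "('a, 'n::finite) riem \<Rightarrow> ('a \<Rightarrow> real \<Rightarrow> real) \<Rightarrow> bool" where
  "smooth_fun_times_real M f \<longleftrightarrow>
     (\<forall>c\<in>atlas M. smooth_within (cimg c \<times> UNIV) (\<lambda>(x, t). f (cinv c x) t))"


subsection \<open>Components of tensors at a point, in a chart\<close>

definition partial :: "('a, 'n::finite) chart \<Rightarrow> ('a \<Rightarrow> real) \<Rightarrow> 'a \<Rightarrow> 'n \<Rightarrow> real" where
  "partial c u p i = pd (cimg c) i (u \<circ> cinv c) (cmap c p)"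

definition hess :: "('a, 'n::finite) riem \<Rightarrow> ('a, 'n) chart \<Rightarrow> ('a \<Rightarrow> real) \<Rightarrow> 'a \<Rightarrow> real^'n^'n" where
  "hess M c u p = hess_coord (cimg c) (metric M c \<circ> cinv c) (u \<circ> cinv c) (cmap c p)"

definition grad_sq :: "('a, 'n::finite) riem \<Rightarrow> ('a, 'n) chart \<Rightarrow> ('a \<Rightarrow> real) \<Rightarrow> 'a \<Rightarrow> real" where
  "grad_sq M c u p = grad_sq_coord (cimg c) (metric M c \<circ> cinv c) (u \<circ> cinv c) (cmap c p)"

definition grad_norm :: "('a, 'n::finite) riem \<Rightarrow> ('a, 'n) chart \<Rightarrow> ('a \<Rightarrow> real) \<Rightarrow> 'a \<Rightarrow> real" where
  "grad_norm M c u p = sqrt (grad_sq M c u p)"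

definition schouten :: "('a, 'n::finite) riem \<Rightarrow> ('a, 'n) chart \<Rightarrow> 'a \<Rightarrow> real^'n^'n" where
  "schouten M c p = schouten_coord (cimg c) (metric M c \<circ> cinv c) (cmap c p)"

definition strictly_convex :: "('a, 'n::finite) riem \<Rightarrow> ('a \<Rightarrow> real) \<Rightarrow> bool" where
  "strictly_convex M w \<longleftrightarrow> (\<forall>c\<in>atlas M. \<forall>p\<in>cdom c. pos_def (hess M c w p))"


subsection \<open>Riemannian distance\<close>

text \<open>
  The speed is independent of the chart containing the point, so any chart may be chosen. Lengths are
  nonnegative Lebesgue integrals, so that a curve whose speed is not integrable has infinite length.
  The distance of points in different components is infinite.
\<close>

definition speed :: "('a, 'n::finite) riem \<Rightarrow> (real \<Rightarrow> 'a) \<Rightarrow> real \<Rightarrow> real" where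
  "speed M \<gamma> t =
     (let c = (SOME c. c \<in> atlas M \<and> \<gamma> t \<in> cdom c);
          v = vector_derivative (cmap c \<circ> \<gamma>) (at t)
      in sqrt (v \<bullet> (metric M c (\<gamma> t) *v v)))"

definition curve_length :: "('a, 'n::finite) riem \<Rightarrow> (real \<Rightarrow> 'a) \<Rightarrow> ennreal" where
  "curve_length M \<gamma> = (\<integral>\<^sup>+t\<in>{0..1}. ennreal (speed M \<gamma> t) \<partial>lborel)"

definition piecewise_C1_curve :: "('a, 'n::finite) riem \<Rightarrow> (real \<Rightarrow> 'a) \<Rightarrow> bool" where
  "piecewise_C1_curve M \<gamma> \<longleftrightarrow> pathin (mtop M) \<gamma> \<and>
     (\<exists>K. finite K \<and> (\<forall>c\<in>atlas M.
        (cmap c \<circ> \<gamma>) C1_differentiable_on {t \<in> {0<..<1} - K. \<gamma> t \<in> cdom c}))"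

definition riem_dist :: "('a, 'n::finite) riem \<Rightarrow> 'a \<Rightarrow> 'a \<Rightarrow> ennreal" where
  "riem_dist M p q = (INF \<gamma>\<in>{\<gamma>. piecewise_C1_curve M \<gamma> \<and> \<gamma> 0 = p \<and> \<gamma> 1 = q}. curve_length M \<gamma>)"

definition dist_boundary :: "('a, 'n::finite) riem \<Rightarrow> 'a \<Rightarrow> ennreal" where
  "dist_boundary M p = (INF q\<in>mboundary M. riem_dist M p q)"


section \<open>The modified Schouten tensor equation\<close>

text \<open>\<open>u\<^sub>i\<^sub>j + \<psi> u\<^sub>i u\<^sub>j - \<psi>/2 |\<nabla>u|\<^sup>2 g\<^sub>i\<^sub>j + T\<^sub>i\<^sub>j\<close>, with \<open>T\<close> given by its components in the chart and at
  the point in question\<close>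

definition mod_tensor ::
    "('a, 'n::finite) riem \<Rightarrow> ('a \<Rightarrow> real) \<Rightarrow> (('a, 'n) chart \<Rightarrow> 'a \<Rightarrow> real^'n^'n) \<Rightarrow> ('a \<Rightarrow> real) \<Rightarrow>
     ('a, 'n) chart \<Rightarrow> 'a \<Rightarrow> real^'n^'n" where
  "mod_tensor M \<psi> T u c p = hess M c u p
     + (\<chi> i j. \<psi> p * partial c u p i * partial c u p j)
     - (1/2 * \<psi> p * grad_sq M c u p) *\<^sub>R metric M c p + T c p"

definition log_det_ratio :: "('a, 'n::finite) riem \<Rightarrow> ('a, 'n) chart \<Rightarrow> 'a \<Rightarrow> real^'n^'n \<Rightarrow> real" where
  "log_det_ratio M c p B = ln (det B / det (metric M c p))"

definition T_tensor ::
    "('a, 'n::finite) riem \<Rightarrow> real \<Rightarrow> ('a \<Rightarrow> real) \<Rightarrow> ('a, 'n) chart \<Rightarrow> 'a \<Rightarrow> real^'n^'n" where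
  "T_tensor M lam \<psi> c p = schouten M c p + (lam * (1 - \<psi> p)) *\<^sub>R metric M c p"

definition admissible_subsolution ::
    "('a, 'n::finite) riem \<Rightarrow> ('a \<Rightarrow> real \<Rightarrow> real) \<Rightarrow> ('a \<Rightarrow> real) \<Rightarrow> bool" where
  "admissible_subsolution M f u \<longleftrightarrow> smooth_fun M u \<and>
     (\<forall>c\<in>atlas M. \<forall>p\<in>cdom c.
        pos_def (mod_tensor M (\<lambda>_. 1) (schouten M) u c p) \<and>
        f p (u p) \<le> log_det_ratio M c p (mod_tensor M (\<lambda>_. 1) (schouten M) u c p))"

definition cutoff_family :: "('a, 'n::finite) riem \<Rightarrow> (nat \<Rightarrow> 'a \<Rightarrow> real) \<Rightarrow> bool" where
  "cutoff_family M \<psi> \<longleftrightarrow> (\<forall>k\<ge>1. smooth_fun M (\<psi> k) \<and>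
     (\<forall>p\<in>carrier_of M. 0 \<le> \<psi> k p \<and> \<psi> k p \<le> 1 \<and>
        (dist_boundary M p < ennreal (1 / real k) \<longrightarrow> \<psi> k p = 0) \<and>
        (ennreal (2 / real k) < dist_boundary M p \<longrightarrow> \<psi> k p = 1)))"

definition lambda_condition ::
    "('a, 'n::finite) riem \<Rightarrow> ('a \<Rightarrow> real \<Rightarrow> real) \<Rightarrow> ('a \<Rightarrow> real) \<Rightarrow> (nat \<Rightarrow> 'a \<Rightarrow> real) \<Rightarrow>
     real \<Rightarrow> bool" where
  "lambda_condition M f u \<psi> lam \<longleftrightarrow> 0 \<le> lam \<and>
     (\<forall>k\<ge>1. \<forall>c\<in>atlas M. \<forall>p\<in>cdom c.
        pos_def (mod_tensor M (\<psi> k) (T_tensor M lam (\<psi> k)) u c p) \<and>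
        f p (u p) \<le> log_det_ratio M c p (mod_tensor M (\<psi> k) (T_tensor M lam (\<psi> k)) u c p))"

definition supersolution ::
    "('a, 'n::finite) riem \<Rightarrow> ('a \<Rightarrow> real \<Rightarrow> real) \<Rightarrow> ('a \<Rightarrow> real) \<Rightarrow> (nat \<Rightarrow> 'a \<Rightarrow> real) \<Rightarrow>
     real \<Rightarrow> ('a \<Rightarrow> real) \<Rightarrow> bool" where
  "supersolution M f usub \<psi> lam u \<longleftrightarrow> smooth_fun M u \<and>
     (\<forall>p\<in>carrier_of M. usub p \<le> u p) \<and>
     (\<forall>k\<ge>1. \<forall>c\<in>atlas M. \<forall>p\<in>cdom c.
        pos_def (mod_tensor M (\<psi> k) (T_tensor M lam (\<psi> k)) u c p) \<longrightarrow>
        log_det_ratio M c p (mod_tensor M (\<psi> k) (T_tensor M lam (\<psi> k)) u c p) \<le> f p (u p))"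

text \<open>Here \<open>\<psi>\<close> is a single cutoff function and \<open>usub\<close> prescribes the boundary values.\<close>

definition admissible_solution ::
    "('a, 'n::finite) riem \<Rightarrow> ('a \<Rightarrow> real \<Rightarrow> real) \<Rightarrow> ('a \<Rightarrow> real) \<Rightarrow> ('a \<Rightarrow> real) \<Rightarrow>
     real \<Rightarrow> ('a \<Rightarrow> real) \<Rightarrow> bool" where
  "admissible_solution M f usub \<psi> lam u \<longleftrightarrow> smooth_fun M u \<and>
     (\<forall>c\<in>atlas M. \<forall>p\<in>cdom c.
        pos_def (mod_tensor M \<psi> (T_tensor M lam \<psi>) u c p) \<and>
        log_det_ratio M c p (mod_tensor M \<psi> (T_tensor M lam \<psi>) u c p) = f p (u p)) \<and>
     (\<forall>p\<in>mboundary M. u p = usub p)"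

end

theory Submission
  imports Defs
begin

text \<open>
  No derivative of the equation is taken, so the derivatives of the cutoff functions never enter.
  Admissibility and \<open>0 \<le> \<psi> \<le> 1\<close> give \<open>u\<^sub>i\<^sub>j + u\<^sub>i u\<^sub>j > - S\<^sub>i\<^sub>j - \<lambda> g\<^sub>i\<^sub>j\<close>, hence the Hessian of \<open>e\<^sup>u\<close> is bounded
  below uniformly in \<open>k\<close>, and \<open>v = e\<^sup>u + \<mu> \<chi>\<close> is strictly convex for a strictly convex \<open>\<chi>\<close> and some
  \<open>\<mu>\<close> depending only on the geometry and the upper barrier. Strict convexity gives
  \<open>\<langle>\<nabla>|\<nabla>v|\<^sup>2, \<nabla>v\<rangle> > 0\<close> where \<open>\<nabla>v\<close> does not vanish, so a maximum of \<open>|\<nabla>v|\<^sup>2\<close> lies on the boundary and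
  \<open>\<nabla>v\<close> points strictly outwards there. As \<open>v \<ge> v\<^sub>0 = e\<^bsup>usub\<^esup> + \<mu> \<chi>\<close> with equality on the boundary, at that
  point \<open>|\<nabla>v|\<^sup>2 = dv(\<nabla>v) \<le> dv\<^sub>0(\<nabla>v)\<close>, whence \<open>|\<nabla>v| \<le> |\<nabla>v\<^sub>0|\<close>.
\<close>

section \<open>Closure properties of functions smooth up to the boundary\<close>

locale half_space_open =
  fixes b :: "'n::finite" and S :: "(real^'n) set"
  assumes openin_half_space: "openin (top_of_set (half_space b)) S"
begin

text \<open>Relative openness puts the half-space part of a small ball into \<open>S\<close>. One
  length \<open>d\<close> therefore serves all directions of norm at most one, and the only
  constraint left is the sign of the \<open>b\<close>-coordinate of the endpoint.\<close>

lemma basis_segment: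
  assumes "x \<in> S"
  shows "\<exists>d>0. \<forall>t. 0 \<le> t \<and> t < d \<longrightarrow> (\<forall>v. norm v \<le> 1 \<and> 0 \<le> x $ b + t * v $ b \<longrightarrow> x + t *\<^sub>R v \<in> S)"
proof -
  obtain T where T: "open T" "S = half_space b \<inter> T"
    using openin_half_space by (auto simp: openin_open)
  then obtain r where r: "r > 0" "ball x r \<subseteq> T"
    using assms by (meson IntD2 open_contains_ball)
  have "x + t *\<^sub>R v \<in> S" if "0 \<le> t" "t < r" "norm v \<le> 1" "0 \<le> x $ b + t * v $ b" for t v
  proof -
    have "dist x (x + t *\<^sub>R v) = t * norm v"
      using that by (simp add: dist_norm)
    also have "\<dots> \<le> t" using that by (simp add: mult_left_le)
    finally have "x + t *\<^sub>R v \<in> ball x r" using that by (simp add: mem_ball)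
    then show ?thesis using T r that by (auto simp: half_space_def)
  qed
  then show ?thesis using r(1) by blast
qed

text \<open>Uniqueness within \<open>S\<close> requires arbitrarily short steps along each basis
  vector. A positive multiple of a basis vector never lowers the \<open>b\<close>-coordinate, so
  such steps stay in \<open>S\<close> even from boundary points.\<close>

lemma frechet_derivative_eq:
  assumes "x \<in> S" "(f has_derivative D) (at x within S)"
  shows "frechet_derivative f (at x within S) = D"
proof (rule frechet_derivative_unique_within[OF _ assms(2)])
  show "(f has_derivative frechet_derivative f (at x within S)) (at x within S)"
    using assms(2) by (meson differentiableI frechet_derivative_works)
next
  fix i :: "real^'n" and e :: real
  assume i: "i \<in> Basis" and e: "0 < e"
  obtain d where d: "d > 0" and *: "\<And>t v. 0 \<le> t \<Longrightarrow> t < d \<Longrightarrow> norm v \<le> 1 \<Longrightarrow> 0 \<le> x $ b + t * v $ b \<Longrightarrow> x + t *\<^sub>R v \<in> S"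
    using basis_segment[OF assms(1)] by blast
  define t where "t = min d e / 2"
  have t: "0 < t" "t < d" "t < e" using d e by (auto simp: t_def)
  obtain j where j: "i = axis j 1" using i by (auto simp: Basis_vec_def)
  have "0 \<le> x $ b"
    using assms(1) openin_half_space by (auto simp: openin_open half_space_def)
  then have "0 \<le> x $ b + t * i $ b" using t by (simp add: j axis_def)
  then have "x + t *\<^sub>R i \<in> S" using * t i by simp
  then show "\<exists>d. 0 < \<bar>d\<bar> \<and> \<bar>d\<bar> < e \<and> x + d *\<^sub>R i \<in> S" using t by (intro exI[of _ t]) auto
qed

lemma dir_deriv_eq:
  "x \<in> S \<Longrightarrow> (f has_derivative D) (at x within S) \<Longrightarrow> dir_deriv S v f x = D v"
  by (simp add: dir_deriv_def frechet_derivative_eq)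

end

text \<open>Both derivatives are choices from the same predicate on linear maps, so they agree at
  non-differentiable points as well.\<close>

lemma dir_deriv_cong:
  assumes "\<And>y. y \<in> S \<Longrightarrow> f y = g y" "x \<in> S"
  shows "dir_deriv S v f x = dir_deriv S v g x"
proof -
  have "(f has_derivative D) (at x within S) \<longleftrightarrow> (g has_derivative D) (at x within S)" for D
    using assms by (metis has_derivative_transform)
  then show ?thesis by (simp add: dir_deriv_def frechet_derivative_def)
qed

text \<open>Differentiation rules identify \<open>dir_deriv S v f\<close> with an explicit formula
  only on \<open>S\<close>; this congruence lets that formula enter the recursion.\<close>

lemma Ck_within_cong:
  assumes "\<And>y. y \<in> S \<Longrightarrow> f y = g y"
  shows "Ck_within k S f \<longleftrightarrow> Ck_within k S g"
  using assms
proof (induction k arbitrary: f g)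
  case 0
  then show ?case by (simp cong: continuous_on_cong)
next
  case (Suc k)
  have "f differentiable_on S \<longleftrightarrow> g differentiable_on S"
    unfolding differentiable_on_def
    by (metis Suc.prems differentiable_transform_within zero_less_one)
  moreover have "Ck_within k S (dir_deriv S v f) \<longleftrightarrow> Ck_within k S (dir_deriv S v g)" for v
    by (rule Suc.IH) (simp add: dir_deriv_cong[OF Suc.prems])
  ultimately show ?case by simp
qed

lemma Ck_within_Suc_imp: "Ck_within (Suc k) S f \<Longrightarrow> Ck_within k S f"
proof (induction k arbitrary: f)
  case 0
  then show ?case by (simp add: differentiable_imp_continuous_on)
next
  case (Suc k)
  then show ?case by (metis Ck_within.simps(2))
qed

lemma has_derivative_dir_deriv:
  "f differentiable_on S \<Longrightarrow> x \<in> S \<Longrightarrow> (f has_derivative (\<lambda>v. dir_deriv S v f x)) (at x within S)"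
  unfolding dir_deriv_def differentiable_on_def using frechet_derivative_works by blast

section \<open>Sums, products, quotients, exponentials and determinants of smooth functions\<close>

context half_space_open
begin

lemma Ck_within_const: "Ck_within k S (\<lambda>x. c)"
proof (induction k arbitrary: c)
  case (Suc k)
  have "Ck_within k S (dir_deriv S v (\<lambda>x. c))" for v
    using dir_deriv_eq[OF _ has_derivative_const] Ck_within_cong[where g = "\<lambda>x. 0"] Suc by blast
  then show ?case by simp
qed simp

lemma Ck_within_bounded_linear:
  assumes "bounded_linear h" "Ck_within k S f"
  shows "Ck_within k S (\<lambda>x. h (f x))"
  using assms(2)
proof (induction k arbitrary: f)
  case 0
  then show ?case using assms(1)
    by (simp add: bounded_linear.continuous_on)
next
  case (Suc k)
  then have d: "f differentiable_on S" by simp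
  have hd: "((\<lambda>x. h (f x)) has_derivative (\<lambda>v. h (dir_deriv S v f x))) (at x within S)" if "x \<in> S" for x
    using has_derivative_dir_deriv[OF d that] bounded_linear.has_derivative[OF assms(1)] by blast
  then have "(\<lambda>x. h (f x)) differentiable_on S"
    by (meson differentiableI differentiable_on_def)
  moreover have "Ck_within k S (dir_deriv S v (\<lambda>x. h (f x)))" if "v \<in> Basis" for v
  proof -
    have "Ck_within k S (\<lambda>x. h (dir_deriv S v f x))" using Suc that by simp
    then show ?thesis using dir_deriv_eq[OF _ hd] Ck_within_cong[where g = "\<lambda>x. h (dir_deriv S v f x)"]
      by blast
  qed
  ultimately show ?case by simp
qed

lemma Ck_within_add:
  assumes "Ck_within k S f" "Ck_within k S g"
  shows "Ck_within k S (\<lambda>x. f x + g x)"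
  using assms
proof (induction k arbitrary: f g)
  case 0
  then show ?case by (simp add: continuous_on_add)
next
  case (Suc k)
  have hd: "((\<lambda>x. f x + g x) has_derivative (\<lambda>v. dir_deriv S v f x + dir_deriv S v g x)) (at x within S)"
    if "x \<in> S" for x
    using Suc.prems that by (intro has_derivative_add has_derivative_dir_deriv) auto
  then have "(\<lambda>x. f x + g x) differentiable_on S"
    by (meson differentiableI differentiable_on_def)
  moreover have "Ck_within k S (dir_deriv S v (\<lambda>x. f x + g x))" if "v \<in> Basis" for v
  proof -
    have "Ck_within k S (\<lambda>x. dir_deriv S v f x + dir_deriv S v g x)" using Suc that by simp
    then show ?thesis
      using dir_deriv_eq[OF _ hd] Ck_within_cong[where g = "\<lambda>x. dir_deriv S v f x + dir_deriv S v g x"]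
      by blast
  qed
  ultimately show ?case by simp
qed

lemma Ck_within_mult:
  fixes f g :: "real^'n \<Rightarrow> real"
  assumes "Ck_within k S f" "Ck_within k S g"
  shows "Ck_within k S (\<lambda>x. f x * g x)"
  using assms
proof (induction k arbitrary: f g)
  case 0
  then show ?case by (simp add: continuous_on_mult)
next
  case (Suc k)
  have hd: "((\<lambda>x. f x * g x) has_derivative (\<lambda>v. f x * dir_deriv S v g x + dir_deriv S v f x * g x)) (at x within S)"
    if "x \<in> S" for x
    using Suc.prems that by (intro has_derivative_mult has_derivative_dir_deriv) auto
  then have "(\<lambda>x. f x * g x) differentiable_on S"
    by (meson differentiableI differentiable_on_def)
  moreover have "Ck_within k S (dir_deriv S v (\<lambda>x. f x * g x))" if "v \<in> Basis" for v
  proof -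
    \<comment> \<open>The product rule leaves one factor undifferentiated, so its regularity is
      lowered from \<open>Suc k\<close> to \<open>k\<close> before the induction hypothesis
      applies.\<close>
    have "Ck_within k S (\<lambda>x. f x * dir_deriv S v g x + dir_deriv S v f x * g x)"
      using Suc that Ck_within_Suc_imp[OF Suc.prems(1)] Ck_within_Suc_imp[OF Suc.prems(2)]
      by (intro Ck_within_add Suc.IH) auto
    then show ?thesis
      using dir_deriv_eq[OF _ hd]
        Ck_within_cong[where g = "\<lambda>x. f x * dir_deriv S v g x + dir_deriv S v f x * g x"]
      by blast
  qed
  ultimately show ?case by simp
qed

text \<open>The derivative of \<open>1/f\<close> is a polynomial in \<open>1/f\<close> and the
  derivative of \<open>f\<close>, so the induction runs over \<open>k\<close> with \<open>f\<close>
  fixed.\<close>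

lemma Ck_within_inverse:
  fixes f :: "real^'n \<Rightarrow> real"
  assumes "Ck_within k S f" and nz: "\<And>x. x \<in> S \<Longrightarrow> f x \<noteq> 0"
  shows "Ck_within k S (\<lambda>x. inverse (f x))"
  using assms(1)
proof (induction k)
  case 0
  then show ?case using nz by (simp add: continuous_on_inverse)
next
  case (Suc k)
  have hd: "((\<lambda>x. inverse (f x)) has_derivative
      (\<lambda>v. (-1) * (inverse (f x) * dir_deriv S v f x * inverse (f x)))) (at x within S)"
    if "x \<in> S" for x
    using Deriv.has_derivative_inverse[OF nz[OF that] has_derivative_dir_deriv[of f S x]] Suc.prems that by simp
  then have "(\<lambda>x. inverse (f x)) differentiable_on S"
    by (meson differentiableI differentiable_on_def)
  moreover have "Ck_within k S (dir_deriv S v (\<lambda>x. inverse (f x)))" if "v \<in> Basis" for v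
  proof -
    let ?g = "\<lambda>x. (-1) * (inverse (f x) * dir_deriv S v f x * inverse (f x))"
    have "Ck_within k S ?g"
      using Suc that Ck_within_Suc_imp[OF Suc.prems]
      by (intro Ck_within_mult Ck_within_const Suc.IH) auto
    then show ?thesis
      using dir_deriv_eq[OF _ hd] Ck_within_cong[where g = ?g] by blast
  qed
  ultimately show ?case by simp
qed

lemma Ck_within_exp:
  fixes f :: "real^'n \<Rightarrow> real"
  assumes "Ck_within k S f"
  shows "Ck_within k S (\<lambda>x. exp (f x))"
  using assms
proof (induction k)
  case 0
  then show ?case by (simp add: continuous_on_exp)
next
  case (Suc k)
  have hd: "((\<lambda>x. exp (f x)) has_derivative (\<lambda>v. dir_deriv S v f x * exp (f x))) (at x within S)"
    if "x \<in> S" for x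
    using has_derivative_exp[OF has_derivative_dir_deriv[of f S x]] Suc.prems that
    by (simp add: mult.commute)
  then have "(\<lambda>x. exp (f x)) differentiable_on S"
    by (meson differentiableI differentiable_on_def)
  moreover have "Ck_within k S (dir_deriv S v (\<lambda>x. exp (f x)))" if "v \<in> Basis" for v
  proof -
    let ?g = "\<lambda>x. dir_deriv S v f x * exp (f x)"
    have "Ck_within k S ?g"
      using Suc that Ck_within_Suc_imp[OF Suc.prems]
      by (intro Ck_within_mult Suc.IH) auto
    then show ?thesis
      using dir_deriv_eq[OF _ hd] Ck_within_cong[where g = ?g] by blast
  qed
  ultimately show ?case by simp
qed

lemma smooth_within_const: "smooth_within S (\<lambda>x. c)"
  by (simp add: smooth_within_def Ck_within_const)

lemma smooth_within_bounded_linear: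
  "bounded_linear h \<Longrightarrow> smooth_within S f \<Longrightarrow> smooth_within S (\<lambda>x. h (f x))"
  by (simp add: smooth_within_def Ck_within_bounded_linear)

lemma smooth_within_add:
  "smooth_within S f \<Longrightarrow> smooth_within S g \<Longrightarrow> smooth_within S (\<lambda>x. f x + g x)"
  by (simp add: smooth_within_def Ck_within_add)

lemma smooth_within_mult:
  fixes f g :: "real^'n \<Rightarrow> real"
  shows "smooth_within S f \<Longrightarrow> smooth_within S g \<Longrightarrow> smooth_within S (\<lambda>x. f x * g x)"
  by (simp add: smooth_within_def Ck_within_mult)

lemma smooth_within_diff:
  fixes f g :: "real^'n \<Rightarrow> real"
  assumes "smooth_within S f" "smooth_within S g"
  shows "smooth_within S (\<lambda>x. f x - g x)"
  using smooth_within_add[OF assms(1) smooth_within_mult[OF smooth_within_const[of "-1"] assms(2)]]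
  by simp

lemma smooth_within_divide:
  fixes f g :: "real^'n \<Rightarrow> real"
  assumes "smooth_within S f" "smooth_within S g" "\<And>x. x \<in> S \<Longrightarrow> g x \<noteq> 0"
  shows "smooth_within S (\<lambda>x. f x / g x)"
  using assms unfolding divide_inverse
  by (intro smooth_within_mult) (auto simp: smooth_within_def Ck_within_inverse)

lemma smooth_within_exp:
  fixes f :: "real^'n \<Rightarrow> real"
  shows "smooth_within S f \<Longrightarrow> smooth_within S (\<lambda>x. exp (f x))"
  by (simp add: smooth_within_def Ck_within_exp)

lemma smooth_within_sum:
  fixes f :: "'i \<Rightarrow> real^'n \<Rightarrow> real"
  assumes "\<And>i. i \<in> I \<Longrightarrow> smooth_within S (f i)"
  shows "smooth_within S (\<lambda>x. \<Sum>i\<in>I. f i x)"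
  using assms
  by (induction I rule: infinite_finite_induct) (auto intro: smooth_within_const smooth_within_add)

lemma smooth_within_prod:
  fixes f :: "'i \<Rightarrow> real^'n \<Rightarrow> real"
  assumes "\<And>i. i \<in> I \<Longrightarrow> smooth_within S (f i)"
  shows "smooth_within S (\<lambda>x. \<Prod>i\<in>I. f i x)"
  using assms
  by (induction I rule: infinite_finite_induct) (auto intro: smooth_within_const smooth_within_mult)

lemma smooth_within_det:
  fixes A :: "real^'n \<Rightarrow> real^'m^'m"
  assumes "\<And>i j. smooth_within S (\<lambda>x. A x $ i $ j)"
  shows "smooth_within S (\<lambda>x. det (A x))"
  unfolding det_def
  by (intro smooth_within_sum smooth_within_mult smooth_within_prod smooth_within_const assms)

end

lemma smooth_within_imp_continuous_on: "smooth_within S f \<Longrightarrow> continuous_on S f"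
  unfolding smooth_within_def by (metis Ck_within.simps(1))

lemma smooth_within_imp_differentiable_on: "smooth_within S f \<Longrightarrow> f differentiable_on S"
  unfolding smooth_within_def by (metis Ck_within.simps(2))

lemma smooth_within_cong:
  "(\<And>y. y \<in> S \<Longrightarrow> f y = g y) \<Longrightarrow> smooth_within S f \<longleftrightarrow> smooth_within S g"
  unfolding smooth_within_def using Ck_within_cong by blast

lemma smooth_within_pd:
  assumes "smooth_within S f"
  shows "smooth_within S (pd S i f)"
proof -
  have "axis i (1::real) \<in> Basis" by simp
  then have "smooth_within S (dir_deriv S (axis i 1) f)"
    using assms unfolding smooth_within_def by (meson Ck_within.simps(2))
  moreover have "pd S i f = dir_deriv S (axis i 1) f" by (auto simp: pd_def)
  ultimately show ?thesis by simp
qed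

section \<open>Gradients of convex functions in coordinates\<close>

lemma pos_def_matrix_inv:
  fixes G :: "real^'n^'n"
  assumes "pos_def G"
  shows "G ** matrix_inv G = mat 1" "matrix_inv G ** G = mat 1"
proof -
  have "\<forall>x. G *v x = 0 \<longrightarrow> x = 0"
    using assms unfolding pos_def_def by (metis inner_zero_right less_irrefl)
  then obtain B where "B ** G = mat 1" using matrix_left_invertible_ker by blast
  then have "\<exists>B. G ** B = mat 1 \<and> B ** G = mat 1"
    using matrix_left_right_inverse by blast
  then have "G ** matrix_inv G = mat 1 \<and> matrix_inv G ** G = mat 1"
    unfolding matrix_inv_def by (rule someI_ex)
  then show "G ** matrix_inv G = mat 1" "matrix_inv G ** G = mat 1" by auto
qed

lemma pos_def_det_nz: "pos_def G \<Longrightarrow> det G \<noteq> 0"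
  using det_mul[of G "matrix_inv G"] by (auto simp: pos_def_matrix_inv)

lemma inner_symmetric_matrix:
  fixes G :: "real^'n^'n"
  assumes "transpose G = G"
  shows "v \<bullet> (G *v w) = w \<bullet> (G *v v)"
  by (metis assms dot_lmul_matrix inner_commute transpose_matrix_vector)

text \<open>Cramer's rule, applied to the columns of the inverse. It presents
  \<open>matrix_inv\<close> by determinants, from which smoothness of the inverse metric can be read
  off.\<close>

lemma matrix_inv_cramer:
  fixes G :: "real^'n^'n"
  assumes "pos_def G"
  shows "matrix_inv G $ i $ j
    = det (\<chi> k l. if l = i then axis j 1 $ k else G $ k $ l) / det G"
proof -
  have "G *v (matrix_inv G *v axis j 1) = axis j 1"
    by (simp add: matrix_vector_mul_assoc pos_def_matrix_inv[OF assms])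
  then have "matrix_inv G *v axis j 1
      = (\<chi> l. det (\<chi> k m. if m = l then axis j 1 $ k else G $ k $ m) / det G)"
    using cramer[OF pos_def_det_nz[OF assms]] by blast
  moreover have "(matrix_inv G *v axis j 1) $ i = matrix_inv G $ i $ j"
    by (simp add: matrix_vector_mul_component inner_axis)
  ultimately show ?thesis by simp
qed

text \<open>The squared length of a covector in the dual metric,
  \<open>g^{ij} a_i a_j\<close>.\<close>

definition conorm_sq :: "real^'n^'n \<Rightarrow> real^'n \<Rightarrow> real" where
  "conorm_sq G a = a \<bullet> (matrix_inv G *v a)"

context
  fixes G :: "real^'n^'n"
  assumes pd: "pos_def G" and sym: "transpose G = G"
begin

lemma metric_sharp: "G *v (matrix_inv G *v a) = a"
  by (simp add: matrix_vector_mul_assoc pos_def_matrix_inv[OF pd])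

lemma pos_def_nonneg: "0 \<le> v \<bullet> (G *v v)"
  using pd unfolding pos_def_def by (cases "v = 0") (auto simp: less_imp_le)

lemma matrix_inv_symmetric: "matrix_inv G $ i $ j = matrix_inv G $ j $ i"
proof -
  have "transpose (matrix_inv G) ** G = transpose (G ** matrix_inv G)"
    by (simp add: matrix_transpose_mul sym)
  also have "\<dots> = mat 1" by (simp add: pos_def_matrix_inv[OF pd] transpose_mat)
  finally have "transpose (matrix_inv G) ** (G ** matrix_inv G) = matrix_inv G"
    by (simp add: matrix_mul_assoc)
  then have "transpose (matrix_inv G) $ j $ i = matrix_inv G $ j $ i"
    by (simp add: pos_def_matrix_inv[OF pd])
  then show ?thesis by (simp add: transpose_def)
qed

lemma conorm_sq_dual: "conorm_sq G a = (matrix_inv G *v a) \<bullet> (G *v (matrix_inv G *v a))"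
  by (simp add: conorm_sq_def metric_sharp inner_commute)

lemma conorm_sq_nonneg: "0 \<le> conorm_sq G a"
  by (simp only: conorm_sq_dual pos_def_nonneg)

text \<open>Expand the squared length of \<open>w - matrix_inv G *v a\<close>. Equality holds when
  \<open>w\<close> is the raised covector, so the left side is a minorant of the dual norm in which
  no inverse metric occurs.\<close>

lemma conorm_sq_ge: "2 * (a \<bullet> w) - w \<bullet> (G *v w) \<le> conorm_sq G a"
proof -
  let ?z = "matrix_inv G *v a"
  have "0 \<le> (w - ?z) \<bullet> (G *v (w - ?z))" by (rule pos_def_nonneg)
  also have "\<dots> = w \<bullet> (G *v w) - ?z \<bullet> (G *v w) - w \<bullet> (G *v ?z) + ?z \<bullet> (G *v ?z)"
    by (simp add: matrix_vector_mult_diff_distrib inner_diff_left inner_diff_right)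
  also have "?z \<bullet> (G *v w) = w \<bullet> (G *v ?z)" by (rule inner_symmetric_matrix[OF sym])
  finally show ?thesis by (simp add: metric_sharp conorm_sq_def inner_commute)
qed

end

lemma conorm_sq_scale: "conorm_sq G (r *\<^sub>R a) = r\<^sup>2 * conorm_sq G a"
  by (simp add: conorm_sq_def matrix_vector_mult_scaleR power2_eq_square)

text \<open>The parallelogram identity, with the term for \<open>a + c\<close> dropped.\<close>

lemma conorm_sq_diff_le:
  assumes "pos_def G" "transpose G = G"
  shows "conorm_sq G (a - c) \<le> 2 * conorm_sq G a + 2 * conorm_sq G c"
proof -
  have "conorm_sq G (a - c) + conorm_sq G (a + c) = 2 * conorm_sq G a + 2 * conorm_sq G c"
    by (simp add: conorm_sq_def matrix_vector_mult_diff_distrib matrix_vector_right_distrib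
        inner_diff_left inner_diff_right inner_add_left inner_add_right)
  then show ?thesis using conorm_sq_nonneg[OF assms, of "a + c"] by linarith
qed

text \<open>The Jacobian maps the raised covector in the new coordinates to the raised covector in
  the old ones, because both solve the same linear system. The pairing of covector and vector is
  then unchanged.\<close>

lemma conorm_sq_transform:
  fixes G J :: "real^'n^'n"
  assumes G: "pos_def G" and G': "pos_def (transpose J ** G ** J)"
  shows "conorm_sq (transpose J ** G ** J) (transpose J *v a) = conorm_sq G a"
proof -
  let ?G' = "transpose J ** G ** J"
  define w where "w = matrix_inv ?G' *v (transpose J *v a)"
  have "det (transpose J) \<noteq> 0"
    using pos_def_det_nz[OF G'] by (auto simp: det_mul)
  then have inj: "transpose J *v x = transpose J *v y \<Longrightarrow> x = y" for x y
    by (metis invertible_det_nz inj_matrix_vector_mult injD)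
  have "?G' *v w = transpose J *v a"
    by (simp add: w_def matrix_vector_mul_assoc pos_def_matrix_inv[OF G'])
  then have "transpose J *v (G *v (J *v w)) = transpose J *v a"
    by (simp add: matrix_vector_mul_assoc matrix_mul_assoc)
  then have "G *v (J *v w) = a" by (rule inj)
  then have "J *v w = matrix_inv G *v a"
    by (metis matrix_vector_mul_assoc matrix_vector_mul_lid pos_def_matrix_inv(2)[OF G])
  moreover have "(transpose J *v a) \<bullet> w = a \<bullet> (J *v w)"
    by (metis dot_lmul_matrix transpose_matrix_vector)
  ultimately show ?thesis by (simp add: conorm_sq_def w_def)
qed

section \<open>The Hessian in the gradient direction and maxima of the squared gradient\<close>

definition covec :: "(real^'n) set \<Rightarrow> (real^'n \<Rightarrow> real) \<Rightarrow> real^'n \<Rightarrow> real^'n" where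
  "covec S f x = (\<chi> i. pd S i f x)"

lemma grad_sq_coord_conorm: "grad_sq_coord S G f x = conorm_sq (G x) (covec S f x)"
  by (simp add: grad_sq_coord_def conorm_sq_def covec_def ginv_def inner_vec_def
      matrix_vector_mult_def sum_distrib_left mult_ac)

lemma has_derivative_covec:
  assumes "f differentiable_on S" "x \<in> S"
  shows "(f has_derivative (\<lambda>v. v \<bullet> covec S f x)) (at x within S)"
proof -
  let ?D = "\<lambda>v. dir_deriv S v f x"
  have D: "(f has_derivative ?D) (at x within S)" using assms by (rule has_derivative_dir_deriv)
  then have lin: "linear ?D" by (simp add: has_derivative_linear)
  have "?D v = v \<bullet> covec S f x" for v
  proof -
    have "?D v = ?D (\<Sum>i\<in>UNIV. v $ i *\<^sub>R axis i 1)"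
      by (metis (no_types, lifting) basis_expansion scalar_mult_eq_scaleR sum.cong)
    also have "\<dots> = (\<Sum>i\<in>UNIV. v $ i * ?D (axis i 1))"
      by (simp add: linear_sum[OF lin] linear_cmul[OF lin])
    finally show ?thesis by (simp add: inner_vec_def covec_def pd_def)
  qed
  then show ?thesis using D by simp
qed

text \<open>Contracting the Christoffel symbols with the differential of \<open>f\<close> turns the
  inverse metric into the gradient \<open>w\<close>. Against the symmetric product of three copies
  of \<open>w\<close>, the three metric derivatives give the same sum, two with a plus sign and one
  with a minus sign.\<close>

lemma quadratic_form_hess_coord:
  assumes "pos_def (G x)" "transpose (G x) = G x"
    and w: "w = matrix_inv (G x) *v covec S f x"
  shows "w \<bullet> (hess_coord S G f x *v w)
    = (\<Sum>i\<in>UNIV. \<Sum>j\<in>UNIV. w $ i * w $ j * pd S i (pd S j f) x)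
      - 1/2 * (\<Sum>i\<in>UNIV. \<Sum>j\<in>UNIV. \<Sum>l\<in>UNIV. w $ i * w $ j * w $ l * pd S i (\<lambda>y. G y $ j $ l) x)"
proof -
  let ?g = "\<lambda>i j l. pd S i (\<lambda>y. G y $ j $ l) x"
  let ?T = "\<Sum>i\<in>UNIV. \<Sum>j\<in>UNIV. \<Sum>l\<in>UNIV. w $ i * w $ j * w $ l * ?g i j l"
  have wl: "w $ l = (\<Sum>k\<in>UNIV. ginv G x k l * pd S k f x)" for l
    unfolding w ginv_def matrix_vector_mult_def covec_def
    using matrix_inv_symmetric[OF assms(1,2)] by simp
  \<comment> \<open>Interchanging the sums collects the inverse metric and the differential into
    \<open>w $ l\<close>.\<close>
  have chr: "(\<Sum>k\<in>UNIV. christoffel S G k i j x * pd S k f x)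
      = 1/2 * (\<Sum>l\<in>UNIV. w $ l * (?g i j l + ?g j i l - ?g l i j))" for i j
  proof -
    have "(\<Sum>k\<in>UNIV. christoffel S G k i j x * pd S k f x)
      = (\<Sum>k\<in>UNIV. \<Sum>l\<in>UNIV. 1/2 * (ginv G x k l * pd S k f x * (?g i j l + ?g j i l - ?g l i j)))"
      unfolding christoffel_def by (simp add: sum_distrib_left sum_distrib_right mult_ac)
    also have "\<dots> = (\<Sum>l\<in>UNIV. \<Sum>k\<in>UNIV. 1/2 * (ginv G x k l * pd S k f x * (?g i j l + ?g j i l - ?g l i j)))"
      by (rule sum.swap)
    also have "\<dots> = (\<Sum>l\<in>UNIV. 1/2 * (w $ l * (?g i j l + ?g j i l - ?g l i j)))"
      unfolding wl sum_distrib_left sum_distrib_right ..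
    finally show ?thesis by (simp add: sum_distrib_left)
  qed
  \<comment> \<open>The cubic monomial in \<open>w\<close> is symmetric, so permuting the summation
    indices reduces the other two metric derivatives to \<open>?T\<close>.\<close>
  have T2: "(\<Sum>i\<in>UNIV. \<Sum>j\<in>UNIV. \<Sum>l\<in>UNIV. w $ i * w $ j * w $ l * ?g j i l) = ?T"
    by (subst sum.swap) (simp add: mult_ac)
  have T3: "(\<Sum>i\<in>UNIV. \<Sum>j\<in>UNIV. \<Sum>l\<in>UNIV. w $ i * w $ j * w $ l * ?g l i j) = ?T"
  proof -
    have "(\<Sum>i\<in>UNIV. \<Sum>j\<in>UNIV. \<Sum>l\<in>UNIV. w $ i * w $ j * w $ l * ?g l i j)
       = (\<Sum>i\<in>UNIV. \<Sum>l\<in>UNIV. \<Sum>j\<in>UNIV. w $ i * w $ j * w $ l * ?g l i j)"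
      by (intro sum.cong refl sum.swap)
    also have "\<dots> = (\<Sum>l\<in>UNIV. \<Sum>i\<in>UNIV. \<Sum>j\<in>UNIV. w $ i * w $ j * w $ l * ?g l i j)"
      by (rule sum.swap)
    finally show ?thesis by (simp add: mult_ac)
  qed
  have "(\<Sum>i\<in>UNIV. \<Sum>j\<in>UNIV. w $ i * w $ j * (\<Sum>k\<in>UNIV. christoffel S G k i j x * pd S k f x))
     = 1/2 * ((\<Sum>i\<in>UNIV. \<Sum>j\<in>UNIV. \<Sum>l\<in>UNIV. w $ i * w $ j * w $ l * ?g i j l)
      + (\<Sum>i\<in>UNIV. \<Sum>j\<in>UNIV. \<Sum>l\<in>UNIV. w $ i * w $ j * w $ l * ?g j i l)
      - (\<Sum>i\<in>UNIV. \<Sum>j\<in>UNIV. \<Sum>l\<in>UNIV. w $ i * w $ j * w $ l * ?g l i j))"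
    unfolding chr sum_distrib_left sum.distrib[symmetric] sum_subtractf[symmetric]
    by (intro sum.cong refl) (simp add: algebra_simps)
  also have "\<dots> = 1/2 * ?T" unfolding T2 T3 by simp
  finally have G: "(\<Sum>i\<in>UNIV. \<Sum>j\<in>UNIV. w $ i * w $ j * (\<Sum>k\<in>UNIV. christoffel S G k i j x * pd S k f x))
    = 1/2 * ?T" .
  have "w \<bullet> (hess_coord S G f x *v w)
    = (\<Sum>i\<in>UNIV. \<Sum>j\<in>UNIV. w $ i * w $ j * (pd S i (pd S j f) x - (\<Sum>k\<in>UNIV. christoffel S G k i j x * pd S k f x)))"
    unfolding inner_vec_def matrix_vector_mult_def hess_coord_def
    by (simp only: vec_lambda_beta inner_real_def sum_distrib_left mult_ac)
  also have "\<dots> = (\<Sum>i\<in>UNIV. \<Sum>j\<in>UNIV. w $ i * w $ j * pd S i (pd S j f) x)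
    - (\<Sum>i\<in>UNIV. \<Sum>j\<in>UNIV. w $ i * w $ j * (\<Sum>k\<in>UNIV. christoffel S G k i j x * pd S k f x))"
    by (simp only: right_diff_distrib sum_subtractf)
  finally show ?thesis unfolding G .
qed

context half_space_open
begin

lemma coord_nonneg: "x \<in> S \<Longrightarrow> 0 \<le> x $ b"
  using openin_half_space by (auto simp: openin_open half_space_def)

lemma covec_eq:
  assumes "x \<in> S" "(f has_derivative (\<lambda>v. v \<bullet> a)) (at x within S)"
  shows "covec S f x = a"
  using dir_deriv_eq[OF assms] by (simp add: covec_def pd_def vec_eq_iff inner_axis')

text \<open>A short segment from \<open>x\<close> along \<open>w\<close> stays in \<open>S\<close>
  if \<open>x\<close> is off the boundary hyperplane or \<open>w\<close> does not point out of the
  half-space. A positive one-sided derivative then produces a larger value on it.\<close>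

lemma increasing_along_inward:
  fixes h :: "real^'n \<Rightarrow> real"
  assumes x: "x \<in> S" and h: "(h has_derivative D) (at x within S)" and "D w > 0"
    and inward: "0 < x $ b \<or> 0 \<le> w $ b"
  shows "\<exists>y\<in>S. h x < h y"
proof -
  have lin: "linear D" using h by (simp add: has_derivative_linear)
  have "w \<noteq> 0" using \<open>D w > 0\<close> linear_0[OF lin] by auto
  define v where "v = (1 / norm w) *\<^sub>R w"
  have v: "norm v = 1" "D v > 0"
    using \<open>w \<noteq> 0\<close> \<open>D w > 0\<close> linear_cmul[OF lin] by (auto simp: v_def)
  have vb: "\<bar>v $ b\<bar> \<le> 1" using component_le_norm_cart[of v b] v by simp
  obtain d where d: "d > 0" and seg: "\<And>t v. 0 \<le> t \<Longrightarrow> t < d \<Longrightarrow> norm v \<le> 1 \<Longrightarrow> 0 \<le> x $ b + t * v $ b \<Longrightarrow> x + t *\<^sub>R v \<in> S"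
    using basis_segment[OF x] by blast
  \<comment> \<open>Off the hyperplane, times below \<open>x $ b\<close> keep the
    \<open>b\<close>-coordinate nonnegative because \<open>v\<close> is a unit vector; on it, the
    sign of \<open>v $ b\<close> does so.\<close>
  obtain e where e: "e > 0" and in_S: "\<And>t. 0 \<le> t \<Longrightarrow> t < e \<Longrightarrow> x + t *\<^sub>R v \<in> S"
  proof (cases "0 < x $ b")
    case True
    have "0 \<le> x $ b + t * v $ b" if "0 \<le> t" "t < min d (x $ b)" for t
    proof -
      have "\<bar>t * v $ b\<bar> \<le> t * 1"
        unfolding abs_mult using that vb by (intro mult_mono) auto
      then show ?thesis using that by linarith
    qed
    then show ?thesis using d True seg v by (intro that[of "min d (x $ b)"]) auto
  next
    case False
    then have "0 \<le> v $ b" using inward by (simp add: v_def)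
    then show ?thesis using d seg v coord_nonneg[OF x] by (intro that[of d]) auto
  qed
  let ?l = "\<lambda>t. x + t *\<^sub>R v"
  have "(?l has_derivative (\<lambda>t. t *\<^sub>R v)) (at 0 within {0..<e})"
    by (auto intro!: derivative_eq_intros)
  moreover have "(h has_derivative D) (at (?l 0) within ?l ` {0..<e})"
    using h in_S by (auto intro: has_derivative_subset)
  ultimately have "((\<lambda>t. h (?l t)) has_derivative (\<lambda>t. D (t *\<^sub>R v))) (at 0 within {0..<e})"
    by (rule has_derivative_in_compose)
  then have "((\<lambda>t. h (?l t)) has_real_derivative D v) (at 0 within {0..<e})"
    by (simp add: has_field_derivative_def linear_cmul[OF lin] mult_commute_abs)
  from has_real_derivative_pos_inc_right[OF this v(2)]
  obtain r where r: "r > 0" "\<And>t. 0 < t \<Longrightarrow> 0 + t \<in> {0..<e} \<Longrightarrow> t < r \<Longrightarrow> h (?l 0) < h (?l (0 + t))"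
    by blast
  define t where "t = min e r / 2"
  have "0 < t" "t < e" "t < r" using e r by (auto simp: t_def)
  then show ?thesis using r(2)[of t] in_S[of t] by auto
qed

end

locale coord_metric = half_space_open b S for b :: "'n::finite" and S +
  fixes G :: "real^'n \<Rightarrow> real^'n^'n"
  assumes smooth_G: "smooth_within S G"
    and pos_G: "x \<in> S \<Longrightarrow> pos_def (G x)"
    and sym_G: "x \<in> S \<Longrightarrow> transpose (G x) = G x"
begin

lemma smooth_G_component: "smooth_within S (\<lambda>y. G y $ i $ j)"
  by (rule smooth_within_bounded_linear[OF _ smooth_G, of "\<lambda>A. A $ i $ j"])
     (intro bounded_linear_compose[OF bounded_linear_vec_nth] bounded_linear_vec_nth)

text \<open>With \<open>w\<close> the gradient at \<open>x\<close>, the function \<open>h y = 2 df(w) - G(w, w)\<close> minorizes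
  \<open>|\<nabla>f|\<^sup>2\<close> with equality at \<open>x\<close>, and its derivative there in direction \<open>w\<close> is twice the
  Hessian of \<open>f\<close> at \<open>(w, w)\<close>; this avoids differentiating the inverse metric.\<close>

lemma grad_sq_max_outward:
  assumes x: "x \<in> S" and f: "smooth_within S f"
    and hess: "pos_def (hess_coord S G f x)" and nz: "covec S f x \<noteq> 0"
    and max: "\<And>y. y \<in> S \<Longrightarrow> grad_sq_coord S G f y \<le> grad_sq_coord S G f x"
  shows "x $ b = 0 \<and> (matrix_inv (G x) *v covec S f x) $ b < 0"
proof -
  define w where "w = matrix_inv (G x) *v covec S f x"
  have Gw: "G x *v w = covec S f x" by (simp add: w_def metric_sharp[OF pos_G[OF x] sym_G[OF x]])
  define h where "h y = (\<Sum>j\<in>UNIV. 2 * w $ j * pd S j f y)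
    - (\<Sum>j\<in>UNIV. \<Sum>l\<in>UNIV. w $ j * w $ l * G y $ j $ l)" for y
  have h_eq: "h y = 2 * (covec S f y \<bullet> w) - w \<bullet> (G y *v w)" for y
    by (simp add: h_def covec_def inner_vec_def matrix_vector_mult_def sum_distrib_left mult_ac)
  have h_le: "h y \<le> grad_sq_coord S G f y" if "y \<in> S" for y
    unfolding h_eq grad_sq_coord_conorm using conorm_sq_ge[OF pos_G sym_G] that by blast
  have h_x: "h x = grad_sq_coord S G f x"
    unfolding h_eq grad_sq_coord_conorm Gw conorm_sq_def
    by (simp add: w_def inner_commute)
  define D where "D v = (\<Sum>j\<in>UNIV. 2 * w $ j * (v \<bullet> covec S (pd S j f) x))
    - (\<Sum>j\<in>UNIV. \<Sum>l\<in>UNIV. w $ j * w $ l * (v \<bullet> covec S (\<lambda>y. G y $ j $ l) x))" for v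
  have hD: "(h has_derivative D) (at x within S)"
    unfolding h_def [abs_def] D_def [abs_def]
    by (intro has_derivative_diff has_derivative_sum has_derivative_mult_right has_derivative_covec
        smooth_within_imp_differentiable_on smooth_within_pd f x smooth_G_component)
  have "D w = 2 * (\<Sum>j\<in>UNIV. \<Sum>i\<in>UNIV. w $ i * w $ j * pd S i (pd S j f) x)
    - (\<Sum>j\<in>UNIV. \<Sum>l\<in>UNIV. \<Sum>i\<in>UNIV. w $ i * w $ j * w $ l * pd S i (\<lambda>y. G y $ j $ l) x)"
    by (simp add: D_def inner_vec_def covec_def sum_distrib_left mult_ac)
  also have "(\<Sum>j\<in>UNIV. \<Sum>i\<in>UNIV. w $ i * w $ j * pd S i (pd S j f) x)
     = (\<Sum>i\<in>UNIV. \<Sum>j\<in>UNIV. w $ i * w $ j * pd S i (pd S j f) x)"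
    by (rule sum.swap)
  also have "(\<Sum>j\<in>UNIV. \<Sum>l\<in>UNIV. \<Sum>i\<in>UNIV. w $ i * w $ j * w $ l * pd S i (\<lambda>y. G y $ j $ l) x)
     = (\<Sum>j\<in>UNIV. \<Sum>i\<in>UNIV. \<Sum>l\<in>UNIV. w $ i * w $ j * w $ l * pd S i (\<lambda>y. G y $ j $ l) x)"
    by (intro sum.cong refl sum.swap)
  also have "\<dots> = (\<Sum>i\<in>UNIV. \<Sum>j\<in>UNIV. \<Sum>l\<in>UNIV. w $ i * w $ j * w $ l * pd S i (\<lambda>y. G y $ j $ l) x)"
    by (rule sum.swap)
  finally have "D w = 2 * (w \<bullet> (hess_coord S G f x *v w))"
    using quadratic_form_hess_coord[where G = G and x = x, OF pos_G[OF x] sym_G[OF x] w_def] by linarith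
  moreover have "w \<noteq> 0" using Gw nz by auto
  ultimately have "D w > 0" using hess by (auto simp: pos_def_def)
  \<comment> \<open>If the gradient direction were available in \<open>S\<close>, then
    \<open>h\<close> would exceed its value at \<open>x\<close> somewhere, and so would the squared
    gradient above it, against maximality.\<close>
  then have "\<not> (0 < x $ b \<or> 0 \<le> w $ b)"
    using increasing_along_inward[OF x hD] h_le h_x max by (metis leD order_trans)
  then show ?thesis using coord_nonneg[OF x] by (auto simp: w_def)
qed

end

section \<open>Smoothness of curvature and domination by a convex Hessian\<close>

lemma abs_quadratic_form_le:
  fixes A :: "real^'n^'n"
  shows "\<bar>v \<bullet> (A *v v)\<bar> \<le> (\<Sum>i\<in>UNIV. \<Sum>j\<in>UNIV. \<bar>A $ i $ j\<bar>) * (norm v)\<^sup>2"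
proof -
  have "\<bar>v \<bullet> (A *v v)\<bar> = \<bar>\<Sum>i\<in>UNIV. \<Sum>j\<in>UNIV. v $ i * (A $ i $ j * v $ j)\<bar>"
    by (simp add: inner_vec_def matrix_vector_mult_def sum_distrib_left)
  also have "\<dots> \<le> (\<Sum>i\<in>UNIV. \<Sum>j\<in>UNIV. \<bar>v $ i * (A $ i $ j * v $ j)\<bar>)"
    by (intro order_trans[OF sum_abs] sum_mono sum_abs)
  also have "\<dots> \<le> (\<Sum>i\<in>UNIV. \<Sum>j\<in>UNIV. norm v * (\<bar>A $ i $ j\<bar> * norm v))"
    unfolding abs_mult by (intro sum_mono mult_mono component_le_norm_cart) auto
  finally show ?thesis by (simp add: sum_distrib_left sum_distrib_right power2_eq_square mult_ac)
qed

text \<open>The form attains a positive minimum on the compact unit sphere; homogeneity extends the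
  bound to all vectors.\<close>

lemma pos_def_coercive:
  fixes A :: "real^'n^'n"
  assumes "pos_def A"
  obtains e where "e > 0" "\<And>v. e * (norm v)\<^sup>2 \<le> v \<bullet> (A *v v)"
proof -
  have "continuous_on (sphere 0 1) (\<lambda>v. v \<bullet> (A *v v))"
    by (intro continuous_on_inner continuous_on_id matrix_vector_mult_linear_continuous_on)
  moreover have "compact (sphere 0 1 :: (real^'n) set)" "sphere 0 1 \<noteq> ({} :: (real^'n) set)"
    by auto
  ultimately obtain w where w: "w \<in> sphere 0 1" "\<And>v. v \<in> sphere 0 1 \<Longrightarrow> w \<bullet> (A *v w) \<le> v \<bullet> (A *v v)"
    using continuous_attains_inf[of "sphere 0 1" "\<lambda>v. v \<bullet> (A *v v)"] by blast
  have "w \<bullet> (A *v w) * (norm v)\<^sup>2 \<le> v \<bullet> (A *v v)" for v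
  proof (cases "v = 0")
    case False
    define z where "z = (1 / norm v) *\<^sub>R v"
    have "z \<in> sphere 0 1" "v = norm v *\<^sub>R z" using False by (auto simp: z_def)
    have "v \<bullet> (A *v v) = (norm v *\<^sub>R z) \<bullet> (A *v (norm v *\<^sub>R z))"
      using \<open>v = norm v *\<^sub>R z\<close> by simp
    also have "\<dots> = z \<bullet> (A *v z) * (norm v)\<^sup>2"
      by (simp add: matrix_vector_mult_scaleR power2_eq_square)
    finally show ?thesis using w(2)[OF \<open>z \<in> sphere 0 1\<close>] by (simp add: mult_right_mono)
  qed simp
  moreover have "w \<noteq> 0" using w(1) by auto
  then have "w \<bullet> (A *v w) > 0" using assms by (simp add: pos_def_def)
  ultimately show ?thesis using that by blast
qed

text \<open>Near \<open>x\<close> the matrix \<open>A\<close> keeps half of its coercivity constant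
  at \<open>x\<close>, while \<open>B\<close> stays bounded by continuity. The quotient of the two
  bounds serves as \<open>m\<close>.\<close>

lemma pos_def_dominates_locally:
  fixes A B :: "'a::topological_space \<Rightarrow> real^'n^'n"
  assumes x: "x \<in> S" and A: "pos_def (A x)"
    and contA: "\<And>i j. continuous_on S (\<lambda>y. A y $ i $ j)"
    and contB: "\<And>i j. continuous_on S (\<lambda>y. B y $ i $ j)"
  obtains m U where "m \<ge> 0" "openin (top_of_set S) U" "x \<in> U"
    "\<And>y v. y \<in> U \<Longrightarrow> v \<bullet> (B y *v v) \<le> m * (v \<bullet> (A y *v v))"
proof -
  obtain e where e: "e > 0" "\<And>v. e * (norm v)\<^sup>2 \<le> v \<bullet> (A x *v v)"
    using pos_def_coercive[OF A] by blast
  \<comment> \<open>Sums of absolute entries bound quadratic forms and are visibly continuous, so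
    they stand in for operator norms.\<close>
  define s where "s y = (\<Sum>i\<in>UNIV. \<Sum>j\<in>UNIV. \<bar>(A y - A x) $ i $ j\<bar>)" for y
  define r where "r y = (\<Sum>i\<in>UNIV. \<Sum>j\<in>UNIV. \<bar>B y $ i $ j\<bar>)" for y
  have "continuous_on S s" "continuous_on S r"
    unfolding s_def r_def vector_minus_component by (intro continuous_intros contA contB)+
  then have "openin (top_of_set S) (S \<inter> s -` {..<e/2})" "openin (top_of_set S) (S \<inter> r -` {..<r x + 1})"
    by (simp_all add: continuous_openin_preimage_gen)
  then have U: "openin (top_of_set S) ((S \<inter> s -` {..<e/2}) \<inter> (S \<inter> r -` {..<r x + 1}))"
    (is "openin _ ?U") by blast
  have r0: "r x \<ge> 0" unfolding r_def by (intro sum_nonneg) auto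
  show ?thesis
  proof (rule that[OF _ U])
    show "0 \<le> (r x + 1) / (e/2)" using e r0 by simp
    show "x \<in> ?U" using x e by (simp add: s_def)
    fix y v assume "y \<in> ?U"
    then have y: "s y < e/2" "r y < r x + 1" by auto
    have "v \<bullet> (B y *v v) \<le> r y * (norm v)\<^sup>2"
      using abs_quadratic_form_le[of v "B y"] by (simp add: r_def)
    also have "\<dots> \<le> (r x + 1) * (norm v)\<^sup>2" using y by (intro mult_right_mono) auto
    finally have b: "v \<bullet> (B y *v v) \<le> (r x + 1) * (norm v)\<^sup>2" .
    have "v \<bullet> ((A y - A x) *v v) \<ge> - (s y * (norm v)\<^sup>2)"
      using abs_quadratic_form_le[of v "A y - A x"] by (simp add: s_def)
    moreover have "s y * (norm v)\<^sup>2 \<le> e/2 * (norm v)\<^sup>2" using y by (intro mult_right_mono) auto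
    ultimately have "e/2 * (norm v)\<^sup>2 \<le> v \<bullet> (A y *v v)"
      using e(2)[of v] by (simp add: matrix_vector_mult_diff_rdistrib inner_diff_right)
    moreover have "(r x + 1) * (norm v)\<^sup>2 = (r x + 1) / (e/2) * (e/2 * (norm v)\<^sup>2)"
      using e(1) by simp
    ultimately have "(r x + 1) * (norm v)\<^sup>2 \<le> (r x + 1) / (e/2) * (v \<bullet> (A y *v v))"
      using e(1) r0 by (simp only: mult_left_mono divide_nonneg_nonneg add_nonneg_nonneg less_imp_le half_gt_zero zero_le_one)
    then show "v \<bullet> (B y *v v) \<le> (r x + 1) / (e/2) * (v \<bullet> (A y *v v))"
      using b by linarith
  qed
qed

section \<open>Smoothness of the coordinate expressions built from the metric\<close>

context coord_metric
begin

lemma smooth_ginv: "smooth_within S (\<lambda>x. ginv G x i j)"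
proof -
  have "smooth_within S (\<lambda>x. det (\<chi> k l. if l = i then axis j 1 $ k else G x $ k $ l) / det (G x))"
  proof (intro smooth_within_divide smooth_within_det)
    show "smooth_within S (\<lambda>x. (\<chi> k l. if l = i then axis j 1 $ k else G x $ k $ l) $ k $ l)" for k l
      using smooth_within_const smooth_G_component by (cases "l = i") auto
  qed (auto simp: smooth_G_component pos_def_det_nz pos_G)
  then show ?thesis
    by (subst smooth_within_cong[where g = "\<lambda>x. det (\<chi> k l. if l = i then axis j 1 $ k else G x $ k $ l) / det (G x)"])
       (auto simp: ginv_def matrix_inv_cramer pos_G)
qed

lemma smooth_christoffel: "smooth_within S (christoffel S G k i j)"
  unfolding christoffel_def [abs_def]
  by (intro smooth_within_mult smooth_within_const smooth_within_sum smooth_within_add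
      smooth_within_diff smooth_within_pd smooth_ginv smooth_G_component)

lemma smooth_riemann: "smooth_within S (riemann S G l k i j)"
  unfolding riemann_def [abs_def]
  by (intro smooth_within_mult smooth_within_sum smooth_within_add
      smooth_within_diff smooth_within_pd smooth_christoffel)

lemma smooth_ricci: "smooth_within S (ricci S G i j)"
  unfolding ricci_def [abs_def] by (intro smooth_within_sum smooth_riemann)

lemma smooth_schouten: "smooth_within S (\<lambda>x. schouten_coord S G x $ i $ j)"
  unfolding schouten_coord_def scalar_curv_def vec_lambda_beta
  by (intro smooth_within_mult smooth_within_const smooth_within_sum
      smooth_within_diff smooth_ginv smooth_ricci smooth_G_component)

lemma smooth_hess_coord:
  assumes "smooth_within S f"
  shows "smooth_within S (\<lambda>x. hess_coord S G f x $ i $ j)"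
  unfolding hess_coord_def vec_lambda_beta
  by (intro smooth_within_mult smooth_within_sum smooth_within_diff smooth_within_pd
      smooth_christoffel assms)

lemma smooth_grad_sq_coord:
  assumes "smooth_within S f"
  shows "smooth_within S (grad_sq_coord S G f)"
  unfolding grad_sq_coord_def [abs_def]
  by (intro smooth_within_mult smooth_within_sum smooth_within_pd smooth_ginv assms)

end

section \<open>Derivatives of \<open>exp f + c g\<close>\<close>

context half_space_open
begin

lemma pd_eq:
  assumes "x \<in> S" "(f has_derivative D) (at x within S)"
  shows "pd S i f x = D (axis i 1)"
  using dir_deriv_eq[OF assms] by (simp add: pd_def)

lemma pd_cong:
  assumes "x \<in> S" "\<And>y. y \<in> S \<Longrightarrow> f y = g y"
  shows "pd S i f x = pd S i g x"
  unfolding pd_def by (rule dir_deriv_cong) (use assms in auto)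

lemma smooth_within_has_derivative:
  assumes "smooth_within S f" "x \<in> S"
  shows "(f has_derivative (\<lambda>v. v \<bullet> covec S f x)) (at x within S)"
  using assms by (simp add: has_derivative_covec smooth_within_imp_differentiable_on)

lemma pd_exp_add:
  assumes "smooth_within S f" "smooth_within S g" "x \<in> S"
  shows "pd S i (\<lambda>y. exp (f y) + c * g y) x = exp (f x) * pd S i f x + c * pd S i g x"
proof -
  have "((\<lambda>y. exp (f y) + c * g y) has_derivative
      (\<lambda>v. v \<bullet> covec S f x * exp (f x) + c * (v \<bullet> covec S g x))) (at x within S)"
    by (intro has_derivative_add has_derivative_exp has_derivative_mult_right smooth_within_has_derivative assms)
  then show ?thesis
    using pd_eq[OF assms(3)] by (simp add: inner_axis' covec_def)
qed

lemma pd_pd_exp_add: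
  assumes f: "smooth_within S f" and g: "smooth_within S g" and x: "x \<in> S"
  shows "pd S i (pd S j (\<lambda>y. exp (f y) + c * g y)) x
    = exp (f x) * (pd S i (pd S j f) x + pd S i f x * pd S j f x) + c * pd S i (pd S j g) x"
proof -
  have "pd S i (pd S j (\<lambda>y. exp (f y) + c * g y)) x
    = pd S i (\<lambda>y. exp (f y) * pd S j f y + c * pd S j g y) x"
    by (intro pd_cong x) (simp add: pd_exp_add f g)
  also have "((\<lambda>y. exp (f y) * pd S j f y + c * pd S j g y) has_derivative
      (\<lambda>v. (exp (f x) * (v \<bullet> covec S (pd S j f) x) + v \<bullet> covec S f x * exp (f x) * pd S j f x)
        + c * (v \<bullet> covec S (pd S j g) x))) (at x within S)"
    by (intro has_derivative_add has_derivative_exp has_derivative_mult_right has_derivative_mult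
        smooth_within_has_derivative smooth_within_pd assms)
  from pd_eq[OF x this] have "pd S i (\<lambda>y. exp (f y) * pd S j f y + c * pd S j g y) x
    = exp (f x) * (pd S i (pd S j f) x + pd S i f x * pd S j f x) + c * pd S i (pd S j g) x"
    by (simp add: inner_axis' covec_def algebra_simps)
  finally show ?thesis .
qed

lemma covec_exp_add:
  assumes "smooth_within S f" "smooth_within S g" "x \<in> S"
  shows "covec S (\<lambda>y. exp (f y) + c * g y) x = exp (f x) *\<^sub>R covec S f x + c *\<^sub>R covec S g x"
  by (simp add: covec_def vec_eq_iff pd_exp_add[OF assms])

text \<open>The exponential contributes exactly the product of first derivatives that occurs in the
  conformal Schouten tensor; the Christoffel terms combine linearly.\<close>

lemma hess_coord_exp_add:
  assumes "smooth_within S f" "smooth_within S g" "x \<in> S"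
  shows "hess_coord S G (\<lambda>y. exp (f y) + c * g y) x
    = exp (f x) *\<^sub>R (hess_coord S G f x + (\<chi> i j. pd S i f x * pd S j f x)) + c *\<^sub>R hess_coord S G g x"
  by (simp add: vec_eq_iff hess_coord_def pd_pd_exp_add[OF assms] pd_exp_add[OF assms]
      sum.distrib sum_distrib_left algebra_simps)

end

section \<open>Gradient bounds on compact manifolds\<close>

lemma continuous_map_attains_sup:
  fixes F :: "'a \<Rightarrow> real"
  assumes "compact_space X" "continuous_map X euclideanreal F" "topspace X \<noteq> {}"
  obtains p where "p \<in> topspace X" "\<And>q. q \<in> topspace X \<Longrightarrow> F q \<le> F p"
proof -
  have "compact (F ` topspace X)"
    using image_compactin[OF _ assms(2)] assms(1) by (simp add: compact_space_def)
  then show ?thesis using compact_attains_sup[of "F ` topspace X"] assms(3) that by auto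
qed

section \<open>Charts, differentials and global bounds on a compact manifold\<close>

locale compact_riemannian =
  fixes M :: "('a, 'n::finite) riem"
  assumes compact_riemannian: "compact_riemannian_manifold_with_boundary M"
begin

lemma atlas_chart: "c \<in> atlas M \<Longrightarrow> is_chart M c"
  and atlas_cover: "(\<Union>c\<in>atlas M. cdom c) = carrier_of M"
  and transition_smooth: "c \<in> atlas M \<Longrightarrow> d \<in> atlas M \<Longrightarrow> smooth_within (overlap c d) (transition c d)"
  and metric_smooth: "c \<in> atlas M \<Longrightarrow> smooth_within (cimg c) (\<lambda>x. metric M c (cinv c x))"
  and metric_sym: "c \<in> atlas M \<Longrightarrow> p \<in> cdom c \<Longrightarrow> transpose (metric M c p) = metric M c p"
  and metric_pos: "c \<in> atlas M \<Longrightarrow> p \<in> cdom c \<Longrightarrow> pos_def (metric M c p)"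
  and metric_transform: "c \<in> atlas M \<Longrightarrow> d \<in> atlas M \<Longrightarrow> p \<in> cdom c \<Longrightarrow> p \<in> cdom d \<Longrightarrow>
    metric M c p = transpose (jacobian c d p) ** metric M d p ** jacobian c d p"
  and compact_top: "compact_space (mtop M)"
  using compact_riemannian
  unfolding compact_riemannian_manifold_with_boundary_def smooth_manifold_with_boundary_def
    riemannian_metric_def
  by blast+

lemma carrier_in_chart: "p \<in> carrier_of M \<Longrightarrow> \<exists>c. c \<in> atlas M \<and> p \<in> cdom c"
  using atlas_cover by blast

context
  fixes c assumes c: "c \<in> atlas M"
begin

lemma cdom_openin: "openin (mtop M) (cdom c)"
  and half_space_open_cimg: "half_space_open (bcoord M) (cimg c)"
  and cmap_homeomorphic: "homeomorphic_map (subtopology (mtop M) (cdom c)) (top_of_set (cimg c)) (cmap c)"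
  using atlas_chart[OF c] by (auto simp: is_chart_def half_space_open_def)

lemma cdom_subset: "cdom c \<subseteq> carrier_of M"
  using cdom_openin by (rule openin_subset)

lemma topspace_cdom: "topspace (subtopology (mtop M) (cdom c)) = cdom c"
  using cdom_subset by auto

lemma cinv_cmap: "p \<in> cdom c \<Longrightarrow> cinv c (cmap c p) = p"
  using homeomorphic_imp_injective_map[OF cmap_homeomorphic]
  unfolding topspace_cdom by (simp add: cinv_def)

lemma cmap_in_cimg: "p \<in> cdom c \<Longrightarrow> cmap c p \<in> cimg c"
  by (simp add: cimg_def)

lemma cinv_in_cdom: "x \<in> cimg c \<Longrightarrow> cinv c x \<in> cdom c"
  and cmap_cinv: "x \<in> cimg c \<Longrightarrow> cmap c (cinv c x) = x"
  by (simp_all add: cinv_def cimg_def inv_into_into f_inv_into_f)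

lemma coord_metric_chart: "coord_metric (bcoord M) (cimg c) (metric M c \<circ> cinv c)"
  using half_space_open_cimg metric_smooth[OF c] metric_sym[OF c] metric_pos[OF c] cinv_in_cdom
  by (simp add: coord_metric_def coord_metric_axioms_def o_def)

lemma metric_chart: "p \<in> cdom c \<Longrightarrow> (metric M c \<circ> cinv c) (cmap c p) = metric M c p"
  by (simp add: cinv_cmap)

lemma smooth_fun_chart: "smooth_fun M u \<Longrightarrow> smooth_within (cimg c) (u \<circ> cinv c)"
  using c by (simp add: smooth_fun_def)

lemma continuous_map_chart:
  assumes "continuous_on (cimg c) h"
  shows "continuous_map (subtopology (mtop M) (cdom c)) euclidean (\<lambda>p. h (cmap c p))"
  using continuous_map_compose[OF homeomorphic_imp_continuous_map[OF cmap_homeomorphic], of euclidean h] assms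
  by (simp add: continuous_map_iff_continuous o_def)

text \<open>The chart is an open map onto its image, and relative openness is transitive.
  Derivatives within the overlap are therefore unique.\<close>

lemma overlap_half_space_open:
  assumes d: "openin (mtop M) (cdom d)"
  shows "half_space_open (bcoord M) (overlap c d)"
proof -
  have "openin (subtopology (mtop M) (cdom c)) (cdom c \<inter> cdom d)"
    using d by (simp add: openin_subtopology_Int2)
  then have "openin (top_of_set (cimg c)) (overlap c d)"
    using homeomorphic_imp_open_map[OF cmap_homeomorphic] by (simp add: open_map_def overlap_def)
  then show ?thesis
    using half_space_open_cimg unfolding half_space_open_def by (rule openin_trans)
qed

end

definition dcovec :: "('a, 'n) chart \<Rightarrow> ('a \<Rightarrow> real) \<Rightarrow> 'a \<Rightarrow> real^'n" where
  "dcovec c u p = covec (cimg c) (u \<circ> cinv c) (cmap c p)"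

lemma partial_dcovec: "partial c u p i = dcovec c u p $ i"
  by (simp add: partial_def dcovec_def covec_def)

lemma grad_sq_dcovec:
  assumes "c \<in> atlas M" "p \<in> cdom c"
  shows "grad_sq M c u p = conorm_sq (metric M c p) (dcovec c u p)"
  using metric_chart[OF assms] by (simp add: grad_sq_def grad_sq_coord_conorm dcovec_def)

text \<open>The chain rule for the transition map, applied within the overlap. Uniqueness of
  derivatives there identifies the result with the differential taken within the whole chart
  image.\<close>

lemma dcovec_transform:
  assumes c: "c \<in> atlas M" and d: "d \<in> atlas M" and p: "p \<in> cdom c" "p \<in> cdom d"
    and u: "smooth_fun M u"
  shows "dcovec c u p = transpose (jacobian c d p) *v dcovec d u p"
proof -
  define x where "x = cmap c p"
  let ?O = "overlap c d" and ?t = "transition c d"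
  interpret O: half_space_open "bcoord M" ?O
    using overlap_half_space_open[OF c cdom_openin[OF d]] .
  have x: "x \<in> ?O" using p by (auto simp: overlap_def x_def)
  have O_cimg: "?O \<subseteq> cimg c" by (auto simp: overlap_def cimg_def)
  have cinv_O: "cinv c y \<in> cdom c \<inter> cdom d" if "y \<in> ?O" for y
    using that cinv_cmap[OF c] by (auto simp: overlap_def)
  have t: "?t y = cmap d (cinv c y)" for y by (simp add: transition_def)
  have tx: "?t x = cmap d p" using cinv_cmap[OF c p(1)] by (simp add: t x_def)
  have t_O: "?t ` ?O \<subseteq> cimg d" using cinv_O cmap_in_cimg[OF d] by (auto simp: t)
  let ?J = "frechet_derivative ?t (at x within ?O)"
  have J: "(?t has_derivative ?J) (at x within ?O)"
    using smooth_within_imp_differentiable_on[OF transition_smooth[OF c d]] x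
    by (simp add: differentiable_on_def frechet_derivative_works)
  have lin: "linear ?J" using J by (rule has_derivative_linear)
  have jac: "?J v = jacobian c d p *v v" for v
    using matrix_works[of ?J] lin by (simp add: jacobian_def x_def linear_matrix_vector_mul_eq)
  have "(u \<circ> cinv d has_derivative (\<lambda>v. v \<bullet> dcovec d u p)) (at (?t x) within cimg d)"
    unfolding tx dcovec_def
    by (intro has_derivative_covec smooth_within_imp_differentiable_on smooth_fun_chart d u cmap_in_cimg p)
  then have "(u \<circ> cinv d has_derivative (\<lambda>v. v \<bullet> dcovec d u p)) (at (?t x) within ?t ` ?O)"
    using t_O by (rule has_derivative_subset)
  from has_derivative_in_compose[OF J this]
  have "((\<lambda>y. (u \<circ> cinv d) (?t y)) has_derivative (\<lambda>v. ?J v \<bullet> dcovec d u p)) (at x within ?O)" .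
  moreover have "?J v \<bullet> dcovec d u p = v \<bullet> (transpose (jacobian c d p) *v dcovec d u p)" for v
    by (metis jac dot_lmul_matrix inner_commute transpose_matrix_vector)
  ultimately have "((\<lambda>y. (u \<circ> cinv d) (?t y)) has_derivative
      (\<lambda>v. v \<bullet> (transpose (jacobian c d p) *v dcovec d u p))) (at x within ?O)"
    by simp
  moreover have "(u \<circ> cinv d) (?t y) = (u \<circ> cinv c) y" if "y \<in> ?O" for y
    using cinv_O[OF that] cinv_cmap[OF d] by (simp add: t)
  ultimately have "(u \<circ> cinv c has_derivative
      (\<lambda>v. v \<bullet> (transpose (jacobian c d p) *v dcovec d u p))) (at x within ?O)"
    using x by (metis (mono_tags, lifting) has_derivative_transform)
  then have "covec ?O (u \<circ> cinv c) x = transpose (jacobian c d p) *v dcovec d u p"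
    by (rule O.covec_eq[OF x])
  moreover have "(u \<circ> cinv c has_derivative (\<lambda>v. v \<bullet> dcovec c u p)) (at x within cimg c)"
    unfolding dcovec_def x_def
    by (intro has_derivative_covec smooth_within_imp_differentiable_on smooth_fun_chart c u cmap_in_cimg p)
  then have "covec ?O (u \<circ> cinv c) x = dcovec c u p"
    using O.covec_eq[OF x] has_derivative_subset[OF _ O_cimg] by blast
  ultimately show ?thesis by simp
qed

lemma grad_sq_chart_independent:
  assumes "c \<in> atlas M" "d \<in> atlas M" "p \<in> cdom c" "p \<in> cdom d" "smooth_fun M u"
  shows "grad_sq M c u p = grad_sq M d u p"
  using conorm_sq_transform[of "metric M d p" "jacobian c d p" "dcovec d u p"]
    metric_pos[of c p] metric_pos[of d p] metric_transform[of c d p] dcovec_transform[of c d p u] assms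
  by (simp add: grad_sq_dcovec)

lemma grad_sq_nonneg: "c \<in> atlas M \<Longrightarrow> p \<in> cdom c \<Longrightarrow> 0 \<le> grad_sq M c u p"
  by (simp add: grad_sq_dcovec conorm_sq_nonneg metric_pos metric_sym)

lemma smooth_fun_continuous_map:
  assumes "smooth_fun M u"
  shows "continuous_map (mtop M) euclideanreal u"
proof (rule pasting_lemma[where I = "atlas M" and T = cdom and f = "\<lambda>_. u"])
  fix c assume c: "c \<in> atlas M"
  have "continuous_map (subtopology (mtop M) (cdom c)) euclideanreal (\<lambda>p. (u \<circ> cinv c) (cmap c p))"
    using c assms
    by (intro continuous_map_chart smooth_within_imp_continuous_on smooth_fun_chart)
  then show "continuous_map (subtopology (mtop M) (cdom c)) euclideanreal u"
    by (rule continuous_map_eq) (simp add: cinv_cmap[OF c])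
qed (use cdom_openin carrier_in_chart in simp_all)

text \<open>Chart independence glues the local squared gradients into one function, and continuity
  is checked on each chart domain. A single function on the manifold is what allows a maximum to be
  taken.\<close>

lemma grad_sq_continuous_map:
  assumes u: "smooth_fun M u"
  obtains F where "continuous_map (mtop M) euclideanreal F"
    "\<And>c p. c \<in> atlas M \<Longrightarrow> p \<in> cdom c \<Longrightarrow> F p = grad_sq M c u p"
proof
  define F where "F p = grad_sq M (SOME c. c \<in> atlas M \<and> p \<in> cdom c) u p" for p
  show F: "F p = grad_sq M c u p" if "c \<in> atlas M" "p \<in> cdom c" for c p
  proof -
    have "(SOME c. c \<in> atlas M \<and> p \<in> cdom c) \<in> atlas M \<and> p \<in> cdom (SOME c. c \<in> atlas M \<and> p \<in> cdom c)"
      by (rule someI[of _ c]) (use that in auto)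
    then show ?thesis unfolding F_def using grad_sq_chart_independent that u by blast
  qed
  show "continuous_map (mtop M) euclideanreal F"
  proof (rule pasting_lemma[where I = "atlas M" and T = cdom and f = "\<lambda>_. F"])
    fix c assume c: "c \<in> atlas M"
    interpret coord_metric "bcoord M" "cimg c" "metric M c \<circ> cinv c"
      using coord_metric_chart[OF c] .
    have "continuous_map (subtopology (mtop M) (cdom c)) euclideanreal
        (\<lambda>p. grad_sq_coord (cimg c) (metric M c \<circ> cinv c) (u \<circ> cinv c) (cmap c p))"
      using c u by (intro continuous_map_chart smooth_within_imp_continuous_on smooth_grad_sq_coord smooth_fun_chart)
    then show "continuous_map (subtopology (mtop M) (cdom c)) euclideanreal F"
      by (rule continuous_map_eq) (simp add: F[OF c] grad_sq_def)
  qed (use cdom_openin carrier_in_chart in simp_all)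
qed

lemma smooth_fun_bounded_above:
  assumes "smooth_fun M u"
  obtains K where "\<And>p. p \<in> carrier_of M \<Longrightarrow> u p \<le> K"
proof (cases "carrier_of M = {}")
  case False
  then show ?thesis
    using continuous_map_attains_sup[OF compact_top smooth_fun_continuous_map[OF assms]] that by metis
qed (use that in auto)

lemma grad_sq_bounded:
  assumes "smooth_fun M u"
  obtains K where "K \<ge> 0" "\<And>c p. c \<in> atlas M \<Longrightarrow> p \<in> cdom c \<Longrightarrow> grad_sq M c u p \<le> K"
proof -
  obtain F where F: "continuous_map (mtop M) euclideanreal F"
    "\<And>c p. c \<in> atlas M \<Longrightarrow> p \<in> cdom c \<Longrightarrow> F p = grad_sq M c u p"
    using grad_sq_continuous_map[OF assms] by blast
  obtain K where K: "\<And>p. p \<in> carrier_of M \<Longrightarrow> F p \<le> K"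
  proof (cases "carrier_of M = {}")
    case False
    then show ?thesis using continuous_map_attains_sup[OF compact_top F(1)] that by metis
  qed (use that in auto)
  \<comment> \<open>The maximum with 0 makes the bound nonnegative also on an empty manifold, where
    \<open>K\<close> is arbitrary.\<close>
  show ?thesis
  proof (rule that[of "max 0 K"])
    show "grad_sq M c u p \<le> max 0 K" if "c \<in> atlas M" "p \<in> cdom c" for c p
      using K[of p] F(2)[OF that] cdom_subset[OF that(1)] that(2) by auto
  qed simp
qed

lemma smooth_fun_exp_add:
  assumes "smooth_fun M u" "smooth_fun M w"
  shows "smooth_fun M (\<lambda>p. exp (u p) + m * w p)"
  unfolding smooth_fun_def
proof
  fix c assume c: "c \<in> atlas M"
  interpret half_space_open "bcoord M" "cimg c" using half_space_open_cimg[OF c] .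
  have "smooth_within (cimg c) (\<lambda>x. exp ((u \<circ> cinv c) x) + m * (w \<circ> cinv c) x)"
    by (intro smooth_within_add smooth_within_exp smooth_within_mult smooth_within_const smooth_fun_chart c assms)
  then show "smooth_within (cimg c) ((\<lambda>p. exp (u p) + m * w p) \<circ> cinv c)"
    by (simp add: o_def)
qed

lemma dcovec_exp_add:
  assumes "smooth_fun M u" "smooth_fun M w" and c: "c \<in> atlas M" and p: "p \<in> cdom c"
  shows "dcovec c (\<lambda>p. exp (u p) + m * w p) p = exp (u p) *\<^sub>R dcovec c u p + m *\<^sub>R dcovec c w p"
proof -
  interpret half_space_open "bcoord M" "cimg c" using half_space_open_cimg[OF c] .
  show ?thesis
    using covec_exp_add[of "u \<circ> cinv c" "w \<circ> cinv c" "cmap c p" m] assms smooth_fun_chart[OF c]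
    by (simp add: dcovec_def o_def cmap_in_cimg cinv_cmap)
qed

lemma hess_exp_add:
  assumes "smooth_fun M u" "smooth_fun M w" and c: "c \<in> atlas M" and p: "p \<in> cdom c"
  shows "hess M c (\<lambda>p. exp (u p) + m * w p) p
    = exp (u p) *\<^sub>R (hess M c u p + (\<chi> i j. partial c u p i * partial c u p j)) + m *\<^sub>R hess M c w p"
proof -
  interpret half_space_open "bcoord M" "cimg c" using half_space_open_cimg[OF c] .
  show ?thesis
    using hess_coord_exp_add[of "u \<circ> cinv c" "w \<circ> cinv c" "cmap c p" "metric M c \<circ> cinv c" m] assms smooth_fun_chart[OF c]
    by (simp add: hess_def partial_def o_def cmap_in_cimg cinv_cmap)
qed

text \<open>At a maximum point with nonzero differential, the gradient \<open>w\<close> of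
  \<open>u\<close> points strictly out of the boundary. There \<open>u0 - u\<close> attains its
  maximum 0, which compares the two differentials along \<open>w\<close>. Convexity is asked in some
  chart at each point, which is the form a covering argument delivers.\<close>

theorem convex_grad_sq_le:
  assumes u: "smooth_fun M u" and u0: "smooth_fun M u0"
    and conv: "\<And>p. p \<in> carrier_of M \<Longrightarrow> \<exists>c\<in>atlas M. p \<in> cdom c \<and> pos_def (hess M c u p)"
    and ge: "\<And>p. p \<in> carrier_of M \<Longrightarrow> u0 p \<le> u p"
    and eq: "\<And>p. p \<in> mboundary M \<Longrightarrow> u p = u0 p"
    and K: "\<And>c p. c \<in> atlas M \<Longrightarrow> p \<in> cdom c \<Longrightarrow> grad_sq M c u0 p \<le> K" "0 \<le> K"
    and c': "c' \<in> atlas M" "p' \<in> cdom c'"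
  shows "grad_sq M c' u p' \<le> K"
proof -
  obtain F where F: "continuous_map (mtop M) euclideanreal F"
    "\<And>c p. c \<in> atlas M \<Longrightarrow> p \<in> cdom c \<Longrightarrow> F p = grad_sq M c u p"
    using grad_sq_continuous_map[OF u] by blast
  have "p' \<in> carrier_of M" using c' cdom_subset by blast
  then obtain p where p: "p \<in> carrier_of M" and max: "\<And>q. q \<in> carrier_of M \<Longrightarrow> F q \<le> F p"
    using continuous_map_attains_sup[OF compact_top F(1)] by (metis empty_iff)
  obtain c where c: "c \<in> atlas M" and pc: "p \<in> cdom c" and hess: "pos_def (hess M c u p)"
    using conv[OF p] by blast
  interpret coord_metric "bcoord M" "cimg c" "metric M c \<circ> cinv c"
    using coord_metric_chart[OF c] .
  define x a a0 where "x = cmap c p" and "a = dcovec c u p" and "a0 = dcovec c u0 p"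
  define G w where "G = metric M c p" and "w = matrix_inv G *v a"
  have x: "x \<in> cimg c" using pc by (simp add: x_def cmap_in_cimg[OF c])
  have Gx: "(metric M c \<circ> cinv c) x = G" using metric_chart[OF c pc] by (simp add: G_def x_def)
  have G: "pos_def G" "transpose G = G" using metric_pos[OF c pc] metric_sym[OF c pc] by (auto simp: G_def)
  have Fp: "F p = conorm_sq G a" by (simp add: F(2)[OF c pc] grad_sq_dcovec[OF c pc] G_def a_def)
  have "F p \<le> K"
  proof (cases "a = 0")
    case True
    then show ?thesis using K(2) by (simp add: Fp conorm_sq_def)
  next
    case False
    have "x $ bcoord M = 0 \<and> w $ bcoord M < 0"
    proof -
      have "grad_sq_coord (cimg c) (metric M c \<circ> cinv c) (u \<circ> cinv c) y
          \<le> grad_sq_coord (cimg c) (metric M c \<circ> cinv c) (u \<circ> cinv c) x" if "y \<in> cimg c" for y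
      proof -
        have q: "cinv c y \<in> cdom c" using cinv_in_cdom[OF c that] .
        have "F (cinv c y) \<le> F p" using max q cdom_subset[OF c] by blast
        then show ?thesis
          using F(2)[OF c q] F(2)[OF c pc] cmap_cinv[OF c that] by (simp add: grad_sq_def x_def)
      qed
      then show ?thesis
        using grad_sq_max_outward[OF x smooth_fun_chart[OF c u]] hess False
        unfolding Gx by (simp add: hess_def x_def a_def dcovec_def w_def)
    qed
    then have xb: "x $ bcoord M = 0" and wb: "0 \<le> (- w) $ bcoord M" by auto
    have "p \<in> mboundary M" using c pc xb by (auto simp: mboundary_def x_def)
    \<comment> \<open>Otherwise \<open>u0 - u\<close> would increase along the inward direction
      \<open>- w\<close> and become positive, contradicting \<open>u0 \<le> u\<close>.\<close>
    have "a \<bullet> w \<le> a0 \<bullet> w"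
    proof (rule ccontr)
      assume "\<not> a \<bullet> w \<le> a0 \<bullet> w"
      then have neg: "0 < (- w) \<bullet> a0 - (- w) \<bullet> a" by (simp add: inner_commute)
      have "((\<lambda>y. (u0 \<circ> cinv c) y - (u \<circ> cinv c) y) has_derivative (\<lambda>v. v \<bullet> a0 - v \<bullet> a)) (at x within cimg c)"
        unfolding a_def a0_def dcovec_def x_def[symmetric]
        by (intro has_derivative_diff smooth_within_has_derivative smooth_fun_chart c u u0 x)
      from increasing_along_inward[OF x this neg] wb
      obtain y where y: "y \<in> cimg c" "u0 (cinv c x) - u (cinv c x) < u0 (cinv c y) - u (cinv c y)"
        by auto
      moreover have "u0 (cinv c x) - u (cinv c x) = 0"
        using eq[OF \<open>p \<in> mboundary M\<close>] by (simp add: x_def cinv_cmap[OF c pc])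
      moreover have "u0 (cinv c y) \<le> u (cinv c y)"
        using ge cinv_in_cdom[OF c y(1)] cdom_subset[OF c] by blast
      ultimately show False by simp
    qed
    \<comment> \<open>Both the squared length of \<open>w\<close> and its pairing with
      \<open>a\<close> equal \<open>F p\<close>, so this minorant is at least
      \<open>2 * F p - F p\<close>; no square roots are needed.\<close>
    moreover have "2 * (a0 \<bullet> w) - w \<bullet> (G *v w) \<le> K"
      using conorm_sq_ge[OF G, of a0 w] K(1)[OF c pc] by (simp add: grad_sq_dcovec[OF c pc] G_def a0_def)
    moreover have "w \<bullet> (G *v w) = F p" "a \<bullet> w = F p"
      using conorm_sq_dual[OF G] by (auto simp: Fp w_def conorm_sq_def)
    ultimately show ?thesis by linarith
  qed
  then show ?thesis
    using max[OF \<open>p' \<in> carrier_of M\<close>] F(2)[OF c'] by simp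
qed

text \<open>A convex Hessian dominates the tensor near each point, and finitely many such
  neighbourhoods cover the compact manifold. The chart at \<open>p\<close> is inherited from the
  neighbourhood containing it.\<close>

lemma schouten_dominated:
  assumes w: "smooth_fun M w" and conv: "strictly_convex M w"
  obtains m where "m \<ge> 0"
    "\<And>p. p \<in> carrier_of M \<Longrightarrow> \<exists>c\<in>atlas M. p \<in> cdom c \<and>
       (\<forall>v. v \<bullet> ((schouten M c p + lam *\<^sub>R metric M c p) *v v) \<le> m * (v \<bullet> (hess M c w p *v v)))"
proof -
  let ?P = "\<lambda>m c p. \<forall>v. v \<bullet> ((schouten M c p + lam *\<^sub>R metric M c p) *v v) \<le> m * (v \<bullet> (hess M c w p *v v))"
  \<comment> \<open>Positivity of the Hessian of \<open>w\<close> allows every local constant to be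
    enlarged.\<close>
  have P_mono: "?P m' c p" if "?P m c p" "m \<le> m'" "c \<in> atlas M" "p \<in> cdom c" for m m' c p
  proof
    fix v
    have "0 \<le> v \<bullet> (hess M c w p *v v)"
      using conv that unfolding strictly_convex_def pos_def_def
      by (metis inner_zero_left less_eq_real_def)
    then show "v \<bullet> ((schouten M c p + lam *\<^sub>R metric M c p) *v v) \<le> m' * (v \<bullet> (hess M c w p *v v))"
      using that(1,2) by (meson mult_right_mono order_trans)
  qed
  define \<U> where "\<U> = {U. openin (mtop M) U \<and> (\<exists>c\<in>atlas M. \<exists>m\<ge>0. U \<subseteq> cdom c \<and> (\<forall>p\<in>U. ?P m c p))}"
  have cover: "\<exists>U\<in>\<U>. p \<in> U" if p: "p \<in> carrier_of M" for p
  proof -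
    obtain c where c: "c \<in> atlas M" and pc: "p \<in> cdom c" using atlas_cover p by blast
    interpret coord_metric "bcoord M" "cimg c" "metric M c \<circ> cinv c"
      using coord_metric_chart[OF c] .
    let ?G = "metric M c \<circ> cinv c"
    let ?A = "hess_coord (cimg c) ?G (w \<circ> cinv c)"
    let ?B = "\<lambda>y. schouten_coord (cimg c) ?G y + lam *\<^sub>R ?G y"
    have A: "pos_def (?A (cmap c p))" using conv c pc by (auto simp: strictly_convex_def hess_def)
    have contA: "continuous_on (cimg c) (\<lambda>y. ?A y $ i $ j)" for i j
      by (intro smooth_within_imp_continuous_on smooth_hess_coord smooth_fun_chart c w)
    have "smooth_within (cimg c) (\<lambda>y. schouten_coord (cimg c) ?G y $ i $ j + lam * ?G y $ i $ j)" for i j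
      by (intro smooth_within_add smooth_within_mult smooth_within_const smooth_schouten smooth_G_component)
    then have contB: "continuous_on (cimg c) (\<lambda>y. ?B y $ i $ j)" for i j
      using smooth_within_imp_continuous_on[of "cimg c" "\<lambda>y. ?B y $ i $ j"] by simp
    obtain m V where V: "m \<ge> 0" "openin (top_of_set (cimg c)) V" "cmap c p \<in> V"
      "\<And>y v. y \<in> V \<Longrightarrow> v \<bullet> (?B y *v v) \<le> m * (v \<bullet> (?A y *v v))"
      using pos_def_dominates_locally[where A = ?A and B = ?B, OF cmap_in_cimg[OF c pc] A contA contB]
      by metis
    define U where "U = {q \<in> cdom c. cmap c q \<in> V}"
    have "openin (subtopology (mtop M) (cdom c)) U"
      using openin_continuous_map_preimage[OF homeomorphic_imp_continuous_map[OF cmap_homeomorphic[OF c]] V(2)]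
      unfolding topspace_cdom[OF c] U_def .
    then have "openin (mtop M) U" using cdom_openin[OF c] by (rule openin_trans_full)
    moreover have "?P m c q" if "q \<in> U" for q
      using V(4)[of "cmap c q"] that cinv_cmap[OF c] by (simp add: U_def schouten_def hess_def)
    ultimately have "U \<in> \<U>" using c V(1) by (auto simp: \<U>_def U_def)
    moreover have "p \<in> U" using pc V(3) by (simp add: U_def)
    ultimately show ?thesis by blast
  qed
  have "\<And>U. U \<in> \<U> \<Longrightarrow> openin (mtop M) U" "carrier_of M \<subseteq> \<Union>\<U>"
    using cover by (auto simp: \<U>_def)
  then obtain \<F> where \<F>: "finite \<F>" "\<F> \<subseteq> \<U>" "carrier_of M \<subseteq> \<Union>\<F>"
    using compact_top unfolding compact_space_alt by metis
  have "\<forall>U\<in>\<F>. \<exists>m\<ge>0. \<exists>c\<in>atlas M. U \<subseteq> cdom c \<and> (\<forall>p\<in>U. ?P m c p)"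
    using \<F>(2) by (force simp: \<U>_def)
  then obtain m where m: "\<And>U. U \<in> \<F> \<Longrightarrow> 0 \<le> m U \<and> (\<exists>c\<in>atlas M. U \<subseteq> cdom c \<and> (\<forall>p\<in>U. ?P (m U) c p))"
    by metis
  \<comment> \<open>The sum of the nonnegative local constants dominates each of them and is 0 for
    an empty cover.\<close>
  show ?thesis
  proof (rule that[of "sum m \<F>"])
    show "0 \<le> sum m \<F>" using m by (simp add: sum_nonneg)
    fix p assume "p \<in> carrier_of M"
    then obtain U where U: "U \<in> \<F>" "p \<in> U" using \<F>(3) by blast
    then obtain c where c: "c \<in> atlas M" "U \<subseteq> cdom c" "?P (m U) c p" using m by blast
    have "m U \<le> sum m \<F>" using U(1) \<F>(1) m by (intro member_le_sum) auto
    then have "?P (sum m \<F>) c p" using P_mono c U(2) by blast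
    then show "\<exists>c\<in>atlas M. p \<in> cdom c \<and> ?P (sum m \<F>) c p" using c U(2) by blast
  qed
qed

section \<open>Convexity of the exponential comparison function and return to
  \<open>u\<close>\<close>

lemma mod_tensor_quadratic_form:
  "v \<bullet> (mod_tensor M \<eta> T u c p *v v)
    = v \<bullet> (hess M c u p *v v) + \<eta> p * (v \<bullet> dcovec c u p)\<^sup>2
      - 1/2 * \<eta> p * grad_sq M c u p * (v \<bullet> (metric M c p *v v)) + v \<bullet> (T c p *v v)"
proof -
  have "(\<chi> i j. r * partial c u p i * partial c u p j) *v v = (r * (v \<bullet> dcovec c u p)) *\<^sub>R dcovec c u p" for r
    by (simp add: vec_eq_iff matrix_vector_mult_def partial_dcovec inner_vec_def sum_distrib_left sum_distrib_right mult_ac)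
  then show ?thesis
    by (simp add: mod_tensor_def matrix_vector_mult_add_rdistrib matrix_vector_mult_diff_rdistrib
        inner_add_right inner_diff_right scaleR_matrix_vector_assoc[symmetric] power2_eq_square inner_commute)
qed

text \<open>Admissibility bounds the Hessian of \<open>exp u\<close> from below by
  \<open>- exp u\<close> times a tensor dominated by \<open>m\<close> times the Hessian of
  \<open>w\<close>. Since \<open>exp (u p) \<le> E\<close>, the constant coefficient
  \<open>m * E\<close> compensates.\<close>

lemma pos_def_hess_exp_add:
  assumes u: "smooth_fun M u" and w: "smooth_fun M w" and c: "c \<in> atlas M" and p: "p \<in> cdom c"
    and adm: "pos_def (mod_tensor M \<eta> (T_tensor M lam \<eta>) u c p)"
    and \<eta>: "0 \<le> \<eta> p" "\<eta> p \<le> 1" and lam: "0 \<le> lam"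
    and conv: "pos_def (hess M c w p)"
    and dom: "\<And>v. v \<bullet> ((schouten M c p + lam *\<^sub>R metric M c p) *v v) \<le> m * (v \<bullet> (hess M c w p *v v))"
    and m: "0 \<le> m" and E: "exp (u p) \<le> E"
  shows "pos_def (hess M c (\<lambda>p. exp (u p) + m * E * w p) p)"
  unfolding pos_def_def
proof (intro allI impI)
  fix v :: "real^'n" assume "v \<noteq> 0"
  define H s where "H = v \<bullet> (hess M c w p *v v)" and "s = (v \<bullet> dcovec c u p)\<^sup>2"
  define g where "g = v \<bullet> (metric M c p *v v)"
  define h t where "h = v \<bullet> (hess M c u p *v v)" and "t = v \<bullet> (schouten M c p *v v)"
  have H: "0 \<le> H" using conv \<open>v \<noteq> 0\<close> by (auto simp: pos_def_def H_def less_imp_le)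
  have g: "0 \<le> g" using metric_pos[OF c p] \<open>v \<noteq> 0\<close> by (auto simp: pos_def_def g_def less_imp_le)
  have "0 < h + \<eta> p * s - 1/2 * \<eta> p * grad_sq M c u p * g + (t + lam * (1 - \<eta> p) * g)"
    using adm \<open>v \<noteq> 0\<close> unfolding pos_def_def mod_tensor_quadratic_form T_tensor_def
    by (simp add: h_def s_def g_def t_def matrix_vector_mult_add_rdistrib inner_add_right
        scaleR_matrix_vector_assoc[symmetric])
  moreover have "0 \<le> 1/2 * \<eta> p * grad_sq M c u p * g"
    using \<eta>(1) g grad_sq_nonneg[OF c p] by (intro mult_nonneg_nonneg) auto
  moreover have "\<eta> p * s \<le> s" using \<eta> by (simp add: s_def mult_left_le_one_le)
  moreover have "lam * (1 - \<eta> p) * g \<le> lam * g"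
    using \<eta> lam g by (simp add: mult_left_le mult_right_mono)
  \<comment> \<open>The gradient term has a favourable sign and is dropped; replacing
    \<open>\<eta> p\<close> by 1 in the rank-one term and by 0 in the multiple of the metric only
    enlarges the sum. No trace of the cutoff remains.\<close>
  ultimately have lower: "0 < h + s + (t + lam * g)" by linarith
  have "t + lam * g \<le> m * H"
    using dom[of v] by (simp add: t_def g_def H_def matrix_vector_mult_add_rdistrib inner_add_right
        scaleR_matrix_vector_assoc[symmetric])
  then have "0 < h + s + m * H" using lower by linarith
  then have "0 < exp (u p) * (h + s + m * H)" by simp
  also have "\<dots> = exp (u p) * (h + s) + exp (u p) * (m * H)" by (simp add: distrib_left)
  \<comment> \<open>Only the term with known sign is enlarged; \<open>h + s\<close> may be negative
    and keeps its factor.\<close>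
  also have "\<dots> \<le> exp (u p) * (h + s) + E * (m * H)"
    using E m H by (intro add_left_mono mult_right_mono) auto
  also have "\<dots> = v \<bullet> (hess M c (\<lambda>p. exp (u p) + m * E * w p) p *v v)"
  proof -
    have "(\<chi> i j. partial c u p i * partial c u p j) *v v = (v \<bullet> dcovec c u p) *\<^sub>R dcovec c u p"
      by (simp add: vec_eq_iff matrix_vector_mult_def partial_dcovec inner_vec_def sum_distrib_left sum_distrib_right mult_ac)
    then show ?thesis
      unfolding hess_exp_add[OF u w c p]
      by (simp add: h_def s_def H_def matrix_vector_mult_add_rdistrib inner_add_right
          scaleR_matrix_vector_assoc[symmetric] power2_eq_square inner_commute algebra_simps)
  qed
  finally show "0 < v \<bullet> (hess M c (\<lambda>p. exp (u p) + m * E * w p) p *v v)" .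
qed

text \<open>The differential of \<open>u\<close> times \<open>exp u\<close> is the difference of the
  differentials of \<open>exp u + m w\<close> and \<open>m w\<close>, so the parallelogram bound
  applies.\<close>

lemma grad_sq_le_exp_add:
  assumes u: "smooth_fun M u" and w: "smooth_fun M w" and c: "c \<in> atlas M" and p: "p \<in> cdom c"
  shows "grad_sq M c u p \<le> exp (- 2 * u p) *
    (2 * grad_sq M c (\<lambda>p. exp (u p) + m * w p) p + 2 * m\<^sup>2 * grad_sq M c w p)"
proof -
  let ?G = "metric M c p"
  have "exp (2 * u p) * conorm_sq ?G (dcovec c u p) = conorm_sq ?G (exp (u p) *\<^sub>R dcovec c u p)"
    by (simp add: conorm_sq_scale power2_eq_square flip: exp_add)
  also have "exp (u p) *\<^sub>R dcovec c u p = dcovec c (\<lambda>p. exp (u p) + m * w p) p - m *\<^sub>R dcovec c w p"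
    by (simp add: dcovec_exp_add[OF u w c p])
  also have "conorm_sq ?G \<dots> \<le> 2 * conorm_sq ?G (dcovec c (\<lambda>p. exp (u p) + m * w p) p)
      + 2 * conorm_sq ?G (m *\<^sub>R dcovec c w p)"
    using metric_pos[OF c p] metric_sym[OF c p] by (rule conorm_sq_diff_le)
  finally have "exp (- 2 * u p) * (exp (2 * u p) * grad_sq M c u p) \<le> exp (- 2 * u p) *
    (2 * grad_sq M c (\<lambda>p. exp (u p) + m * w p) p + 2 * m\<^sup>2 * grad_sq M c w p)"
    by (simp add: grad_sq_dcovec[OF c p] conorm_sq_scale)
  then show ?thesis by (simp add: mult.assoc[symmetric] flip: exp_add)
qed

end

section \<open>The gradient bound, uniform in the cutoff index\<close>

theorem lemma4p1:
  fixes M :: "('a, 'n::finite) riem"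
    and f :: "'a \<Rightarrow> real \<Rightarrow> real"
    and usub usup :: "'a \<Rightarrow> real"
    and \<psi> :: "nat \<Rightarrow> 'a \<Rightarrow> real"
    and lam :: real
  assumes "CARD('n) \<ge> 3"
    and "compact_riemannian_manifold_with_boundary M"
    and "smooth_fun_times_real M f"
    and "admissible_subsolution M f usub"
    and "cutoff_family M \<psi>"
    and "lambda_condition M f usub \<psi> lam"
    and "supersolution M f usub \<psi> lam usup"
    and "\<exists>w. smooth_fun M w \<and> strictly_convex M w"
  shows "\<exists>C. \<forall>k\<ge>1. \<forall>u.
           admissible_solution M f usub (\<psi> k) lam u \<and>
           (\<forall>p\<in>carrier_of M. usub p \<le> u p \<and> u p \<le> usup p) \<longrightarrow>
           (\<forall>c\<in>atlas M. \<forall>p\<in>cdom c. grad_norm M c u p \<le> C)"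
proof -
  interpret compact_riemannian M using assms(2) by unfold_locales
  obtain w where w: "smooth_fun M w" "strictly_convex M w" using assms(8) by blast
  have usub: "smooth_fun M usub" and usup: "smooth_fun M usup" and lam: "0 \<le> lam"
    using assms(4,6,7) by (auto simp: admissible_subsolution_def supersolution_def lambda_condition_def)
  have \<psi>: "0 \<le> \<psi> k p" "\<psi> k p \<le> 1" if "k \<ge> 1" "p \<in> carrier_of M" for k p
    using assms(5) that by (auto simp: cutoff_family_def)
  \<comment> \<open>An upper bound for \<open>- usub\<close> bounds every \<open>u\<close> from
    below, which controls the factor \<open>exp (- 2 * u p)\<close> at the end.\<close>
  have "smooth_fun M (\<lambda>p. - usub p)"
    unfolding smooth_fun_def
  proof
    fix c assume c: "c \<in> atlas M"
    interpret half_space_open "bcoord M" "cimg c" using half_space_open_cimg[OF c] .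
    have "smooth_within (cimg c) (\<lambda>x. (-1) * (usub \<circ> cinv c) x)"
      by (intro smooth_within_mult smooth_within_const smooth_fun_chart c usub)
    then show "smooth_within (cimg c) ((\<lambda>p. - usub p) \<circ> cinv c)" by (simp add: o_def)
  qed
  then obtain b0 where b0: "\<And>p. p \<in> carrier_of M \<Longrightarrow> - usub p \<le> b0"
    using smooth_fun_bounded_above by blast
  obtain b1 where b1: "\<And>p. p \<in> carrier_of M \<Longrightarrow> usup p \<le> b1"
    using smooth_fun_bounded_above[OF usup] by blast
  obtain m where m: "m \<ge> 0" and dom: "\<And>p. p \<in> carrier_of M \<Longrightarrow> \<exists>c\<in>atlas M. p \<in> cdom c \<and>
      (\<forall>v. v \<bullet> ((schouten M c p + lam *\<^sub>R metric M c p) *v v) \<le> m * (v \<bullet> (hess M c w p *v v)))"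
    using schouten_dominated[OF w] by blast
  \<comment> \<open>Here \<open>m\<close> absorbs the Schouten tensor plus \<open>lam\<close> times
    the metric, and \<open>exp b1\<close> bounds \<open>exp u\<close> through the upper
    barrier.\<close>
  define \<mu> where "\<mu> = m * exp b1"
  obtain K where K: "K \<ge> 0"
    "\<And>c p. c \<in> atlas M \<Longrightarrow> p \<in> cdom c \<Longrightarrow> grad_sq M c (\<lambda>p. exp (usub p) + \<mu> * w p) p \<le> K"
    using grad_sq_bounded[OF smooth_fun_exp_add[OF usub w(1), of \<mu>]] by blast
  obtain L where L: "L \<ge> 0" "\<And>c p. c \<in> atlas M \<Longrightarrow> p \<in> cdom c \<Longrightarrow> grad_sq M c w p \<le> L"
    using grad_sq_bounded[OF w(1)] by blast
  show ?thesis
  \<comment> \<open>The witness stays schematic until the last estimate. It is introduced before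
    \<open>k\<close> and \<open>u\<close>, so it can involve only \<open>b0\<close>,
    \<open>\<mu>\<close>, \<open>K\<close>, \<open>L\<close> and other data fixed above.\<close>
  proof (intro exI allI impI ballI)
    fix k u c p
    assume k: "k \<ge> (1::nat)" and "admissible_solution M f usub (\<psi> k) lam u \<and>
        (\<forall>p\<in>carrier_of M. usub p \<le> u p \<and> u p \<le> usup p)"
      and c: "c \<in> atlas M" and p: "p \<in> cdom c"
    then have u: "smooth_fun M u"
      and adm: "\<And>c p. c \<in> atlas M \<Longrightarrow> p \<in> cdom c \<Longrightarrow> pos_def (mod_tensor M (\<psi> k) (T_tensor M lam (\<psi> k)) u c p)"
      and bd: "\<And>p. p \<in> mboundary M \<Longrightarrow> u p = usub p"
      and lo: "\<And>p. p \<in> carrier_of M \<Longrightarrow> usub p \<le> u p" and up: "\<And>p. p \<in> carrier_of M \<Longrightarrow> u p \<le> usup p"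
      by (auto simp: admissible_solution_def)
    have conv: "\<exists>c\<in>atlas M. q \<in> cdom c \<and> pos_def (hess M c (\<lambda>p. exp (u p) + \<mu> * w p) q)"
      if q: "q \<in> carrier_of M" for q
    proof -
      obtain d where d: "d \<in> atlas M" "q \<in> cdom d"
        "\<And>v. v \<bullet> ((schouten M d q + lam *\<^sub>R metric M d q) *v v) \<le> m * (v \<bullet> (hess M d w q *v v))"
        using dom[OF q] by blast
      have "exp (u q) \<le> exp b1" using up[OF q] b1[OF q] by simp
      then have "pos_def (hess M d (\<lambda>p. exp (u p) + \<mu> * w p) q)"
        unfolding \<mu>_def using w(2) d
        by (intro pos_def_hess_exp_add[OF u w(1) d(1,2) adm[OF d(1,2)] \<psi>[OF k q] lam _ d(3) m])
           (auto simp: strictly_convex_def)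
      then show ?thesis using d by blast
    qed
    \<comment> \<open>Both comparison functions carry the same summand \<open>\<mu> * w p\<close>,
      so the ordering of \<open>usub\<close> and \<open>u\<close> and their equality on the boundary
      pass to them.\<close>
    have "grad_sq M c (\<lambda>p. exp (u p) + \<mu> * w p) p \<le> K"
      by (rule convex_grad_sq_le[OF smooth_fun_exp_add[OF u w(1)] smooth_fun_exp_add[OF usub w(1)] conv _ _ K(2,1) c p])
         (auto simp: lo bd)
    moreover have "\<mu>\<^sup>2 * grad_sq M c w p \<le> \<mu>\<^sup>2 * L" using L(2)[OF c p] by (simp add: mult_left_mono)
    ultimately have "2 * grad_sq M c (\<lambda>p. exp (u p) + \<mu> * w p) p + 2 * \<mu>\<^sup>2 * grad_sq M c w p \<le> 2 * K + 2 * \<mu>\<^sup>2 * L"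
      by simp
    moreover have "exp (- 2 * u p) \<le> exp (2 * b0)"
    proof -
      have "p \<in> carrier_of M" using c p cdom_subset by blast
      then show ?thesis using b0[of p] lo[of p] by simp
    qed
    ultimately have "grad_sq M c u p \<le> exp (2 * b0) * (2 * K + 2 * \<mu>\<^sup>2 * L)"
      using grad_sq_nonneg[OF c p] K(1) L(1)
      by (intro order_trans[OF grad_sq_le_exp_add[OF u w(1) c p, of \<mu>] mult_mono]) auto
    then show "grad_norm M c u p \<le> sqrt (exp (2 * b0) * (2 * K + 2 * \<mu>\<^sup>2 * L))"
      by (simp add: grad_norm_def)
  qed
qed

end
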